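(* Let $d,m$ be positive integers, let $f:\mathbb{R}^d\to\mathbb{R}^d$ and $g_k:\mathbb{R}^d\to\mathbb{R}^d$, $k\in\{1,\dots,m\}$, be continuously differentiable, and let $\kappa=(\kappa_1,\dots,\kappa_m):\mathbb{R}^d\to\mathbb{R}^m$ be a feedback such that: (1) the nominal closed-loop system $\dot x(t)=f(x(t))+\sum_{k=1}^m g_k(x(t))\kappa_k(x(t))$ has a hyperbolic and locally asymptotically stable equilibrium at $0\in\mathbb{R}^d$; (2) the map $\xi\mapsto f(\xi)+\sum_{k=1}^m g_k(\xi)\kappa_k(\xi)$ is twice continuously differentiable in a neighborhood of $0$; (3) $f(0)=0$ and $\kappa_k(0)=0$ for each $k\in\{1,\dots,m\}$. Let $\mathcal{R}_{cl}\subset\mathbb{R}^d$ be the basin of attraction of the equilibrium $0$ of the nominal closed-loop system. Fix $t_0\ge 0$ and $T>0$. For a switching-time function $\tau(\cdot)$ (as defined in the context) and $\bar x\in\mathbb{R}^d$ let $z(\cdot;\bar x,\hat\sigma(\cdot;\tau),t_0)$ denote the solution of $$\dot z(t)=f(z(t))+m\,g_{\hat\sigma(t-t_0;\tau)}(z(t))\,\kappa_{\hat\sigma(t-t_0;\tau)}(z(t)),\qquad z(t_0)=\bar x,\quad t\ge t_0,$$ where $$\hat\sigma(s;\tau)=1+\left\lfloor \frac{s-m\tau(s)\lfloor s/(m\tau(s))\rfloor}{\tau(s)}\right\rfloor\in\{1,\dots,m\},\qquad s\ge 0.$$ Then for every point $\bar x\in\mathcal{R}_{cl}$ there exists a switching-time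 function $\tau'(\cdot;\bar x)$ (depending on the initial condition $\bar x$) such that for any switching-time function $\tau$ that dominates $\tau'(\cdot;\bar x)$, $$z(t;\bar x,\hat\sigma(\cdot;\tau),t_0)\to 0\quad\text{as } t\to+\infty .$$
   Context: An equilibrium point of a system with continuously differentiable vector field is hyperbolic if the Jacobian of the vector field at that point has no eigenvalue on the imaginary axis. The basin of attraction of an asymptotically stable equilibrium $0$ is the set of initial conditions whose trajectories converge to $0$ as $t\to+\infty$. Switching-time function: with $T>0$ fixed, a piecewise constant non-increasing function $\tau:[0,+\infty[\,\to\,]0,+\infty[$ with $\tau(s)\to 0$ as $s\to+\infty$, which is constant on each interval $[(n-1)T,nT[$, $n\in\{1,2,\dots\}$; here $s=t-t_0$ is the time elapsed since $t_0$, so the switching time is held constant for $t\in[t_0+(n-1)T,\,t_0+nT[$. A switching-time function $\tau$ dominates another one $\tau'$ if $\tau(s)\le\tau'(s)$ for each $s$. Standing assumptions: for all systems considered (the nominal closed-loop system and the scheduled systems) the right-hand side is measurable in $t$ and locally Lipschitz in the state, and (Carathéodory) solutions are unique and exist for all $t\ge t_0$. *)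

theory Defs
  imports "HOL-Analysis.Analysis"
begin

section \<open>Smoothness\<close>

text \<open>Both notions are meant for an open set \<open>S\<close>.\<close>

definition C1_on :: "'a::real_normed_vector set \<Rightarrow> ('a \<Rightarrow> 'b::real_normed_vector) \<Rightarrow> bool" where
  "C1_on S F \<longleftrightarrow> (\<exists>F' :: 'a \<Rightarrow> 'a \<Rightarrow>\<^sub>L 'b.
     (\<forall>x\<in>S. (F has_derivative blinfun_apply (F' x)) (at x)) \<and> continuous_on S F')"

definition C2_on :: "'a::real_normed_vector set \<Rightarrow> ('a \<Rightarrow> 'b::real_normed_vector) \<Rightarrow> bool" where
  "C2_on S F \<longleftrightarrow> (\<exists>F' :: 'a \<Rightarrow> 'a \<Rightarrow>\<^sub>L 'b.
     (\<forall>x\<in>S. (F has_derivative blinfun_apply (F' x)) (at x)) \<and> C1_on S F')"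

section \<open>Caratheodory solutions\<close>

text \<open>The families of non-overlapping subintervals in the usual epsilon-delta definition are the
  finite families \<open>d\<close> of compact intervals that are divisions of their own union.\<close>

definition absolutely_continuous_on :: "real set \<Rightarrow> (real \<Rightarrow> 'a::real_normed_vector) \<Rightarrow> bool" where
  "absolutely_continuous_on S z \<longleftrightarrow> (\<forall>\<epsilon>>0. \<exists>\<delta>>0. \<forall>d.
     d division_of \<Union>d \<and> \<Union>d \<subseteq> S \<and> (\<Sum>k\<in>d. Sup k - Inf k) < \<delta> \<longrightarrow>
     (\<Sum>k\<in>d. norm (z (Sup k) - z (Inf k))) < \<epsilon>)"

text \<open>Solutions of \<open>z' = X t z\<close>, \<open>z t0 = x\<close> on \<open>[t0, \<infinity>)\<close>; the values of \<open>z\<close> before \<open>t0\<close> are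
  irrelevant.\<close>

definition caratheodory_solution ::
    "(real \<Rightarrow> 'a \<Rightarrow> 'a::euclidean_space) \<Rightarrow> real \<Rightarrow> 'a \<Rightarrow> (real \<Rightarrow> 'a) \<Rightarrow> bool" where
  "caratheodory_solution X t0 x z \<longleftrightarrow>
     z t0 = x \<and>
     (\<forall>b\<ge>t0. absolutely_continuous_on {t0..b} z) \<and>
     (AE t in lebesgue_on {t0..}. (z has_vector_derivative X t (z t)) (at t))"

text \<open>The regularity and well-posedness required of every system under consideration.\<close>

definition well_posed :: "(real \<Rightarrow> 'a \<Rightarrow> 'a::euclidean_space) \<Rightarrow> real \<Rightarrow> bool" where
  "well_posed X t0 \<longleftrightarrow>
     (\<forall>\<xi>. (\<lambda>t. X t \<xi>) \<in> borel_measurable (lebesgue_on {t0..})) \<and>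
     local_lipschitz {t0..} UNIV X \<and>
     (\<forall>x. \<exists>z. caratheodory_solution X t0 x z) \<and>
     (\<forall>x y z. caratheodory_solution X t0 x y \<and> caratheodory_solution X t0 x z \<longrightarrow>
        (\<forall>t\<ge>t0. y t = z t))"

section \<open>Equilibria of autonomous systems\<close>

text \<open>Trajectories of the autonomous vector field \<open>F\<close> are started at time \<open>t0\<close>; by translation
  invariance none of the following notions depends on \<open>t0\<close>.\<close>

definition basin_of_attraction :: "('a \<Rightarrow> 'a::euclidean_space) \<Rightarrow> real \<Rightarrow> 'a \<Rightarrow> 'a set" where
  "basin_of_attraction F t0 p =
     {x. \<exists>z. caratheodory_solution (\<lambda>t. F) t0 x z \<and> (z \<longlongrightarrow> p) at_top}"

definition lyapunov_stable :: "('a \<Rightarrow> 'a::euclidean_space) \<Rightarrow> real \<Rightarrow> 'a \<Rightarrow> bool" where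
  "lyapunov_stable F t0 p \<longleftrightarrow> (\<forall>\<epsilon>>0. \<exists>\<delta>>0. \<forall>x z.
     dist x p < \<delta> \<and> caratheodory_solution (\<lambda>t. F) t0 x z \<longrightarrow> (\<forall>t\<ge>t0. dist (z t) p < \<epsilon>))"

definition locally_asymptotically_stable_equilibrium ::
    "('a \<Rightarrow> 'a::euclidean_space) \<Rightarrow> real \<Rightarrow> 'a \<Rightarrow> bool" where
  "locally_asymptotically_stable_equilibrium F t0 p \<longleftrightarrow>
     F p = 0 \<and> lyapunov_stable F t0 p \<and> (\<exists>\<delta>>0. ball p \<delta> \<subseteq> basin_of_attraction F t0 p)"

definition complex_eigenvalue :: "real^'n^'n \<Rightarrow> complex \<Rightarrow> bool" where
  "complex_eigenvalue A c \<longleftrightarrow>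
     (\<exists>v :: complex^'n. v \<noteq> 0 \<and> (\<chi> i j. complex_of_real (A $ i $ j)) *v v = c *s v)"

definition hyperbolic_equilibrium :: "(real^'n \<Rightarrow> real^'n) \<Rightarrow> real^'n \<Rightarrow> bool" where
  "hyperbolic_equilibrium F p \<longleftrightarrow>
     F p = 0 \<and> F differentiable (at p) \<and>
     (\<forall>c. complex_eigenvalue (matrix (frechet_derivative F (at p))) c \<longrightarrow> Re c \<noteq> 0)"

section \<open>Switching\<close>

text \<open>Only the values on \<open>[0, \<infinity>)\<close> matter. Piecewise constancy is the third clause.\<close>

definition switching_time_function :: "real \<Rightarrow> (real \<Rightarrow> real) \<Rightarrow> bool" where
  "switching_time_function T \<tau> \<longleftrightarrow>
     (\<forall>s\<ge>0. \<tau> s > 0) \<and>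
     antimono_on {0..} \<tau> \<and>
     (\<forall>n::nat. n \<ge> 1 \<longrightarrow> \<tau> constant_on {(real n - 1) * T ..< real n * T}) \<and>
     (\<tau> \<longlongrightarrow> 0) at_top"

definition dominates :: "(real \<Rightarrow> real) \<Rightarrow> (real \<Rightarrow> real) \<Rightarrow> bool" where
  "dominates \<tau> \<tau>' \<longleftrightarrow> (\<forall>s\<ge>0. \<tau> s \<le> \<tau>' s)"

definition sigma_hat :: "nat \<Rightarrow> (real \<Rightarrow> real) \<Rightarrow> real \<Rightarrow> nat" where
  "sigma_hat m \<tau> s = 1 + nat \<lfloor>(s - real m * \<tau> s * of_int \<lfloor>s / (real m * \<tau> s)\<rfloor>) / \<tau> s\<rfloor>"

text \<open>The truncation in \<^term>\<open>sigma_hat\<close> is harmless:\<close>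

lemma sigma_hat_eq_and_range:
  assumes m: "m \<ge> 1" and tau: "\<tau> s > 0"
  shows "int (sigma_hat m \<tau> s) =
           1 + \<lfloor>(s - real m * \<tau> s * of_int \<lfloor>s / (real m * \<tau> s)\<rfloor>) / \<tau> s\<rfloor>"
    and "sigma_hat m \<tau> s \<in> {1..m}"
proof -
  let ?p = "real m * \<tau> s" and ?q = "of_int \<lfloor>s / (real m * \<tau> s)\<rfloor> :: real"
  let ?r = "(s - ?p * ?q) / \<tau> s"
  have p: "?p > 0" using m tau by simp
  have q: "?q \<le> s / ?p" "s / ?p < ?q + 1" by linarith+
  have "0 \<le> s - ?p * ?q" using iffD1[OF pos_le_divide_eq[OF p] q(1)] by (simp only: mult.commute diff_ge_0_iff_ge)
  moreover have "s - ?p * ?q < ?p" using iffD1[OF pos_divide_less_eq[OF p] q(2)] by (simp add: algebra_simps)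
  ultimately have r: "0 \<le> ?r" "?r < real m"
    using tau by (simp_all add: divide_less_eq)
  then have "0 \<le> \<lfloor>?r\<rfloor>" "\<lfloor>?r\<rfloor> < int m" by (simp_all add: floor_less_iff)
  then have "nat \<lfloor>?r\<rfloor> < m" "int (nat \<lfloor>?r\<rfloor>) = \<lfloor>?r\<rfloor>" by linarith+
  then show "int (sigma_hat m \<tau> s) = 1 + \<lfloor>?r\<rfloor>" "sigma_hat m \<tau> s \<in> {1..m}"
    unfolding sigma_hat_def by (simp_all only: of_nat_add of_nat_1 atLeastAtMost_iff) linarith
qed

section \<open>The nominal and the scheduled systems\<close>

definition nominal_field ::
    "nat \<Rightarrow> ('a \<Rightarrow> 'a) \<Rightarrow> (nat \<Rightarrow> 'a \<Rightarrow> 'a) \<Rightarrow> (nat \<Rightarrow> 'a \<Rightarrow> real) \<Rightarrow> 'a \<Rightarrow> 'a::euclidean_space" where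
  "nominal_field m f g \<kappa> \<xi> = f \<xi> + (\<Sum>k=1..m. \<kappa> k \<xi> *\<^sub>R g k \<xi>)"

definition scheduled_field ::
    "nat \<Rightarrow> ('a \<Rightarrow> 'a) \<Rightarrow> (nat \<Rightarrow> 'a \<Rightarrow> 'a) \<Rightarrow> (nat \<Rightarrow> 'a \<Rightarrow> real) \<Rightarrow> (real \<Rightarrow> real) \<Rightarrow> real
      \<Rightarrow> real \<Rightarrow> 'a \<Rightarrow> 'a::euclidean_space" where
  "scheduled_field m f g \<kappa> \<tau> t0 t \<xi> =
     (let k = sigma_hat m \<tau> (t - t0) in f \<xi> + (real m * \<kappa> k \<xi>) *\<^sub>R g k \<xi>)"

end

(* Over a full switching period m * \<tau> the scheduled curve and the nominal one move by the same
   multiple of the nominal field, up to an error of second order in the period. A discrete Gronwall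
   argument over the periods shows that on a bounded time interval the two curves stay as close as
   desired once the switching times are small enough. The nominal flow attracts a neighbourhood of 0
   uniformly, by stability and compactness. Time is therefore cut into stages of finite length: in
   stage n the nominal flow contracts a ball of radius d n well into one of radius d (n + 1), and so
   does the scheduled flow if \<tau> is small during this stage. Letting \<tau>' meet the demands of all
   stages forces convergence. *)

theory Submission
  imports Defs
begin

text \<open>Scheduled solutions enter through one inequality: if the field along the curve stays
  within \<open>B\<close> of \<open>c\<close>, the displacement is the duration times
  \<open>c\<close>, up to the duration times \<open>B\<close>. It replaces integrals of a field that
  jumps in time. Three obstacles shape the estimates. No continuity of \<open>\<kappa>\<close> is
  assumed, so Lipschitz constants of the components come from the well-posedness of a suitable
  scheduled system. They are valid on bounded sets only, so closeness and confinement of the curves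
  are proved together, by a bootstrap. The switching pattern is aligned with multiples of
  \<open>m * \<theta>\<close> counted from elapsed time 0, not from the start of the interval on
  which \<open>\<tau>\<close> equals \<open>\<theta>\<close>, so such an interval may begin and end
  with an incomplete period. The Gronwall factor grows exponentially with time, so one nominal curve
  cannot be followed forever. Each stage restarts the comparison with the nominal curve through the
  current scheduled position and inherits no error. Thresholds do not depend on when a stage starts,
  so all lengths and thresholds can be fixed in advance.\<close>

subsection \<open>Absolutely continuous functions\<close>

text \<open>A gauge argument. In a fine tagged division, intervals tagged outside \<open>N\<close>
  satisfy the estimate up to \<open>e\<close> by differentiability at the tag. Intervals tagged in
  \<open>N\<close> lie in a small open set, so absolute continuity makes their total increment
  small.\<close>

lemma absolutely_continuous_on_mean_value_bound:
  fixes w :: "real \<Rightarrow> 'a::real_normed_vector"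
  assumes ac: "absolutely_continuous_on {a..b} w" and ab: "a \<le> b" and B: "B \<ge> 0"
    and null: "N \<in> null_sets lebesgue"
    and der: "\<And>t. t \<in> {a..b} - N \<Longrightarrow>
      \<exists>w'. (w has_vector_derivative w') (at t within {a..b}) \<and> norm (w' - c) \<le> B"
  shows "norm (w b - w a - (b - a) *\<^sub>R c) \<le> B * (b - a)"
proof -
  define \<phi> :: "real set \<Rightarrow> 'a" where "\<phi> K = w (Sup K) - w (Inf K) - (Sup K - Inf K) *\<^sub>R c" for K
  have approx: "norm (w b - w a - (b - a) *\<^sub>R c) \<le> (B + e) * (b - a) + (e + e * norm c)" if e: "e > 0" for e
  proof -
    obtain \<delta>0 where \<delta>0: "\<delta>0 > 0" and acd: "\<And>d. d division_of \<Union>d \<Longrightarrow> \<Union>d \<subseteq> {a..b} \<Longrightarrow>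
        (\<Sum>k\<in>d. Sup k - Inf k) < \<delta>0 \<Longrightarrow> (\<Sum>k\<in>d. norm (w (Sup k) - w (Inf k))) < e"
      using ac[unfolded absolutely_continuous_on_def, rule_format, OF e] by auto
    \<comment> \<open>The cap by \<open>e\<close> also controls the part of the bad intervals that
      is proportional to \<open>norm c\<close>.\<close>
    define \<delta> where "\<delta> = min \<delta>0 e"
    have \<delta>: "\<delta> > 0" "\<delta> \<le> \<delta>0" "\<delta> \<le> e" using \<delta>0 e by (auto simp: \<delta>_def)
    obtain U where U: "open U" "N \<subseteq> U" "U - N \<in> lmeasurable" "emeasure lebesgue (U - N) < ennreal \<delta>"
      using sets_lebesgue_outer_open[of N \<delta>] null \<delta> by (auto simp: null_sets_def)
    have Nl: "N \<in> lmeasurable" "measure lebesgue N = 0"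
      using null by (auto simp: fmeasurable_def null_sets_def measure_def)
    have UN: "U = (U - N) \<union> N" using U(2) by blast
    have Ul: "U \<in> lmeasurable" by (subst UN) (intro fmeasurable.Un U Nl)
    have "measure lebesgue U \<le> measure lebesgue (U - N) + measure lebesgue N"
      by (subst UN) (intro measure_Un_le fmeasurableD U Nl)
    also have "\<dots> < \<delta>" using U(3,4) \<delta> Nl
      by (simp add: emeasure_eq_measure2 ennreal_less_iff)
    finally have Um: "measure lebesgue U < \<delta>" .
    have "\<exists>r>0. \<forall>y\<in>{a..b}. norm (y - x) < r \<longrightarrow> norm (w y - w x - (y - x) *\<^sub>R c) \<le> (B + e) * norm (y - x)"
      if x: "x \<in> {a..b} - N" for x
    proof -
      obtain w' where w': "(w has_vector_derivative w') (at x within {a..b})" "norm (w' - c) \<le> B"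
        using der[OF x] by blast
      then obtain r where r: "r > 0" "\<And>y. y \<in> {a..b} \<Longrightarrow> norm (y - x) < r \<Longrightarrow>
          norm (w y - w x - (y - x) *\<^sub>R w') \<le> e * norm (y - x)"
        using e unfolding has_vector_derivative_def has_derivative_within_alt by blast
      have "norm (w y - w x - (y - x) *\<^sub>R c) \<le> (B + e) * norm (y - x)"
        if y: "y \<in> {a..b}" "norm (y - x) < r" for y
      proof -
        have "w y - w x - (y - x) *\<^sub>R c = (w y - w x - (y - x) *\<^sub>R w') + (y - x) *\<^sub>R (w' - c)"
          by (simp add: algebra_simps)
        also have "norm \<dots> \<le> e * norm (y - x) + norm (y - x) * B"
          by (rule norm_triangle_mono[OF r(2)[OF y]]) (simp add: w'(2) mult_left_mono)
        finally show ?thesis by (simp add: algebra_simps)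
      qed
      then show ?thesis using r(1) by blast
    qed
    then obtain r where r: "\<And>x. x \<in> {a..b} - N \<Longrightarrow> r x > 0"
      "\<And>x y. x \<in> {a..b} - N \<Longrightarrow> y \<in> {a..b} \<Longrightarrow> norm (y - x) < r x \<Longrightarrow>
          norm (w y - w x - (y - x) *\<^sub>R c) \<le> (B + e) * norm (y - x)"
      by metis
    \<comment> \<open>Tags lie in \<open>{a..b}\<close>; the value \<open>UNIV\<close> is a default
      that makes \<open>\<gamma>\<close> a gauge on the whole line.\<close>
    define \<gamma> where "\<gamma> x = (if x \<in> N then U else if x \<in> {a..b} then ball x (r x) else UNIV)" for x
    have "gauge \<gamma>"
      using U r(1) by (auto simp: gauge_def \<gamma>_def)
    then obtain p where p: "p tagged_division_of {a..b}" "\<gamma> fine p"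
      using fine_division_exists_real by blast
    note pD = tagged_division_ofD[OF p(1)]
    have iv: "\<exists>u v. K = {u..v} \<and> u \<le> x \<and> x \<le> v \<and> a \<le> u \<and> v \<le> b \<and> Inf K = u \<and> Sup K = v" if xK: "(x, K) \<in> p" for x K
    proof -
      obtain u v where K: "K = {u..v}" using pD(4)[OF xK] by auto
      have "x \<in> K" "K \<subseteq> {a..b}" using pD(2,3)[OF xK] by auto
      then show ?thesis using K by auto
    qed
    define P where "P = {xk \<in> p. fst xk \<in> N}"
    have Pp: "P \<subseteq> p" and fin: "finite P" "finite p" using pD(1) by (auto simp: P_def)
    have partial: "P tagged_partial_division_of {a..b}"
      using p(1) Pp tagged_partial_division_subset by (auto simp: tagged_division_of_def)
    have div: "snd ` P division_of \<Union>(snd ` P)"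
      by (rule partial_division_of_tagged_division[OF partial])
    \<comment> \<open>Absolute continuity sums over intervals, a tagged division over pairs. An
      interval with two tags has empty interior, hence is a single point and contributes zero, so
      both sums agree.\<close>
    have unique: "Sup (snd y) = Inf (snd y)" if h: "x \<in> P" "y \<in> P" "x \<noteq> y" "snd x = snd y" for x y
    proof -
      obtain x1 K y1 where xy: "x = (x1, K)" "y = (y1, K)" using h(4) by (metis prod.collapse)
      then have "(x1, K) \<in> p" "(y1, K) \<in> p" using h Pp by auto
      then have "interior K = {}" "\<exists>u v. K = {u..v} \<and> u \<le> v" using pD(5) iv h(3) xy by fastforce+
      then show ?thesis using xy by auto
    qed
    have "(\<Sum>K\<in>snd ` P. Sup K - Inf K) = (\<Sum>K\<in>snd ` P. measure lebesgue K)"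
    proof (rule sum.cong[OF refl])
      fix K assume "K \<in> snd ` P"
      then obtain x where "(x, K) \<in> p" using Pp by force
      then obtain u v where "K = {u..v}" "u \<le> v" using iv by fastforce
      then show "Sup K - Inf K = measure lebesgue K" by simp
    qed
    also have "\<dots> = measure lebesgue (\<Union>(snd ` P))" by (rule content_division[OF div])
    also have "\<dots> \<le> measure lebesgue U"
    proof (rule measure_mono_fmeasurable)
      show "\<Union>(snd ` P) \<subseteq> U"
        using fineD[OF p(2)] by (fastforce simp: P_def \<gamma>_def)
      show "\<Union>(snd ` P) \<in> sets lebesgue"
        using lmeasurable_division[OF div] by (rule fmeasurableD)
    qed (rule Ul)
    finally have small: "(\<Sum>K\<in>snd ` P. Sup K - Inf K) < \<delta>" using Um by simp
    have "\<Union>(snd ` P) \<subseteq> {a..b}" using pD(3) Pp by force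
    then have "(\<Sum>K\<in>snd ` P. norm (w (Sup K) - w (Inf K))) < e"
      using acd[OF div] small \<delta> by simp
    moreover have "(\<Sum>(x,K)\<in>P. norm (w (Sup K) - w (Inf K))) = (\<Sum>K\<in>snd ` P. norm (w (Sup K) - w (Inf K)))"
      using unique by (subst sum.reindex_nontrivial[OF fin(1)]) (auto simp: case_prod_unfold)
    moreover have "(\<Sum>(x,K)\<in>P. Sup K - Inf K) = (\<Sum>K\<in>snd ` P. Sup K - Inf K)"
      using unique by (subst sum.reindex_nontrivial[OF fin(1)]) (auto simp: case_prod_unfold)
    ultimately have bad: "(\<Sum>(x,K)\<in>P. norm (w (Sup K) - w (Inf K))) < e" "(\<Sum>(x,K)\<in>P. Sup K - Inf K) < e"
      using small \<delta> by auto
    have "norm (\<Sum>(x,K)\<in>P. \<phi> K) \<le> (\<Sum>(x,K)\<in>P. norm (w (Sup K) - w (Inf K)) + (Sup K - Inf K) * norm c)"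
    proof (rule sum_norm_le, clarify)
      fix x K assume "(x, K) \<in> P"
      then have "(x, K) \<in> p" using Pp by blast
      then obtain u v where K: "u \<le> v" "Inf K = u" "Sup K = v" using iv by fastforce
      show "norm (\<phi> K) \<le> norm (w (Sup K) - w (Inf K)) + (Sup K - Inf K) * norm c"
        unfolding \<phi>_def by (rule order_trans[OF norm_triangle_ineq4]) (simp add: K)
    qed
    also have "\<dots> = (\<Sum>(x,K)\<in>P. norm (w (Sup K) - w (Inf K))) + (\<Sum>(x,K)\<in>P. Sup K - Inf K) * norm c"
      by (simp add: case_prod_unfold sum.distrib sum_distrib_right)
    also have "\<dots> \<le> e + e * norm c"
      using bad by (intro add_mono mult_right_mono) auto
    finally have sumP: "norm (\<Sum>(x,K)\<in>P. \<phi> K) \<le> e + e * norm c" .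
    have "norm (\<Sum>(x,K)\<in>p - P. \<phi> K) \<le> (\<Sum>(x,K)\<in>p - P. (B + e) * (Sup K - Inf K))"
    proof (rule sum_norm_le, clarify)
      fix x K assume xK: "(x, K) \<in> p" "(x, K) \<notin> P"
      obtain u v where K: "K = {u..v}" "u \<le> x" "x \<le> v" "a \<le> u" "v \<le> b" "Inf K = u" "Sup K = v"
        using iv[OF xK(1)] by blast
      have x: "x \<in> {a..b} - N" using xK K by (auto simp: P_def)
      have "K \<subseteq> ball x (r x)" using fineD[OF p(2) xK(1)] x by (auto simp: \<gamma>_def)
      moreover have "u \<in> K" "v \<in> K" using K by auto
      ultimately have "u \<in> ball x (r x)" "v \<in> ball x (r x)" by blast+
      then have "norm (u - x) < r x" "norm (v - x) < r x" by (auto simp: dist_norm norm_minus_commute)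
      moreover have "u \<in> {a..b}" "v \<in> {a..b}" using K by auto
      ultimately have uv: "norm (u - x) < r x" "norm (v - x) < r x" "u \<in> {a..b}" "v \<in> {a..b}" by blast+
      \<comment> \<open>Splitting at the tag lets the derivative estimate at \<open>x\<close> act on
        both halves, whose lengths add up to that of \<open>K\<close>.\<close>
      have "\<phi> K = (w v - w x - (v - x) *\<^sub>R c) - (w u - w x - (u - x) *\<^sub>R c)"
        by (simp add: \<phi>_def K(6,7) algebra_simps)
      also have "norm \<dots> \<le> (B + e) * norm (v - x) + (B + e) * norm (u - x)"
        by (rule order_trans[OF norm_triangle_ineq4 add_mono[OF r(2)[OF x uv(4,2)] r(2)[OF x uv(3,1)]]])
      finally have "norm (\<phi> K) \<le> (B + e) * norm (v - x) + (B + e) * norm (u - x)" .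
      then show "norm (\<phi> K) \<le> (B + e) * (Sup K - Inf K)" using K(2,3,6,7) by (simp add: algebra_simps)
    qed
    also have "\<dots> \<le> (\<Sum>(x,K)\<in>p. (B + e) * (Sup K - Inf K))"
      using fin B e iv by (intro sum_mono2) fastforce+
    also have "\<dots> = (B + e) * (\<Sum>(x,K)\<in>p. Sup K - Inf K)"
      by (simp add: case_prod_unfold sum_distrib_left)
    also have "\<dots> = (B + e) * (b - a)"
      using additive_tagged_division_1[OF ab p(1), of "\<lambda>t. t"] by simp
    finally have sumG: "norm (\<Sum>(x,K)\<in>p - P. \<phi> K) \<le> (B + e) * (b - a)" .
    have "w b - w a - (b - a) *\<^sub>R c = (\<Sum>(x,K)\<in>p. \<phi> K)"
      using additive_tagged_division_1[OF ab p(1), of "\<lambda>t. w t - t *\<^sub>R c"]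
      by (simp add: \<phi>_def algebra_simps)
    also have "\<dots> = (\<Sum>(x,K)\<in>p - P. \<phi> K) + (\<Sum>(x,K)\<in>P. \<phi> K)"
      by (rule sum.subset_diff[OF Pp fin(2)])
    finally show ?thesis using norm_triangle_mono[OF sumG sumP] by simp
  qed
  have "((\<lambda>e. (B + e) * (b - a) + (e + e * norm c)) \<longlongrightarrow> (B + 0) * (b - a) + (0 + 0 * norm c)) (at_right 0)"
    by (intro tendsto_intros)
  moreover have "\<forall>\<^sub>F e in at_right (0::real). norm (w b - w a - (b - a) *\<^sub>R c) \<le> (B + e) * (b - a) + (e + e * norm c)"
    using approx by (auto simp: eventually_at_right_field intro: exI[of _ 1])
  ultimately have "norm (w b - w a - (b - a) *\<^sub>R c) \<le> (B + 0) * (b - a) + (0 + 0 * norm c)"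
    by (intro tendsto_lowerbound[of _ _ "at_right 0"]) auto
  then show ?thesis by simp
qed

lemma absolutely_continuous_on_subset:
  "absolutely_continuous_on S z \<Longrightarrow> T \<subseteq> S \<Longrightarrow> absolutely_continuous_on T z"
  unfolding absolutely_continuous_on_def by (meson order_trans)

lemma absolutely_continuous_on_imp_continuous_on:
  fixes z :: "real \<Rightarrow> 'a::real_normed_vector"
  assumes "absolutely_continuous_on {a..b} z"
  shows "continuous_on {a..b} z"
  unfolding continuous_on_iff
proof (intro ballI allI impI)
  fix x e :: real assume x: "x \<in> {a..b}" and e: "e > 0"
  obtain \<delta> where \<delta>: "\<delta> > 0" and acd: "\<And>d. d division_of \<Union>d \<Longrightarrow> \<Union>d \<subseteq> {a..b} \<Longrightarrow>
      (\<Sum>k\<in>d. Sup k - Inf k) < \<delta> \<Longrightarrow> (\<Sum>k\<in>d. norm (z (Sup k) - z (Inf k))) < e"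
    using assms[unfolded absolutely_continuous_on_def, rule_format, OF e] by auto
  have "dist (z y) (z x) < e" if y: "y \<in> {a..b}" "dist y x < \<delta>" for y
  proof -
    have "{{min x y..max x y}} division_of \<Union>{{min x y..max x y}}"
      using division_of_self[of "min x y" "max x y"] by simp
    then have "norm (z (max x y) - z (min x y)) < e"
      using acd[of "{{min x y..max x y}}"] x y by (auto simp: dist_real_def)
    then show ?thesis by (auto simp: dist_norm min_def max_def norm_minus_commute split: if_splits)
  qed
  then show "\<exists>d>0. \<forall>y\<in>{a..b}. dist y x < d \<longrightarrow> dist (z y) (z x) < e" using \<delta> by blast
qed

lemma absolutely_continuous_on_Lipschitz:
  fixes z :: "real \<Rightarrow> 'a::real_normed_vector"
  assumes lip: "\<And>u v. u \<in> S \<Longrightarrow> v \<in> S \<Longrightarrow> u \<le> v \<Longrightarrow> norm (z v - z u) \<le> M * (v - u)" and M: "M \<ge> 0"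
  shows "absolutely_continuous_on S z"
  unfolding absolutely_continuous_on_def
proof (intro allI impI)
  fix \<epsilon> :: real assume \<epsilon>: "\<epsilon> > 0"
  \<comment> \<open>Dividing by \<open>M + 1\<close> instead of \<open>M\<close> covers
    \<open>M = 0\<close>.\<close>
  have "(\<Sum>k\<in>d. norm (z (Sup k) - z (Inf k))) < \<epsilon>"
    if d: "d division_of \<Union>d" "\<Union>d \<subseteq> S" and small: "(\<Sum>k\<in>d. Sup k - Inf k) < \<epsilon> / (M + 1)" for d
  proof -
    have iv: "Inf K \<in> S \<and> Sup K \<in> S \<and> Inf K \<le> Sup K" if K: "K \<in> d" for K
    proof -
      obtain u v where "K = cbox u v" "K \<noteq> {}" using division_ofD(3,4)[OF d(1) K] by blast
      then have "K = {u..v}" "u \<le> v" by auto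
      moreover from this have "u \<in> K" "v \<in> K" by auto
      then have "u \<in> S" "v \<in> S" using d(2) K by blast+
      ultimately show ?thesis by simp
    qed
    have "(\<Sum>k\<in>d. norm (z (Sup k) - z (Inf k))) \<le> (\<Sum>k\<in>d. M * (Sup k - Inf k))"
      by (intro sum_mono lip) (use iv in auto)
    also have "\<dots> \<le> (M + 1) * (\<Sum>k\<in>d. Sup k - Inf k)"
      unfolding sum_distrib_left by (intro sum_mono mult_right_mono) (use iv in auto)
    also have "\<dots> < (M + 1) * (\<epsilon> / (M + 1))"
      using small M by (intro mult_strict_left_mono) auto
    finally show ?thesis using M by simp
  qed
  moreover have "\<epsilon> / (M + 1) > 0" using \<epsilon> M by simp
  ultimately show "\<exists>\<delta>>0. \<forall>d. d division_of \<Union>d \<and> \<Union>d \<subseteq> S \<and> (\<Sum>k\<in>d. Sup k - Inf k) < \<delta> \<longrightarrow>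
      (\<Sum>k\<in>d. norm (z (Sup k) - z (Inf k))) < \<epsilon>" by blast
qed

subsection \<open>Solutions as mean value curves\<close>

text \<open>An integral-free form of the Caratheodory equation that, unlike absolute continuity and
  almost everywhere differentiability, is immediately stable under translation and restriction.\<close>

definition mean_value_curve :: "(real \<Rightarrow> 'a \<Rightarrow> 'a::euclidean_space) \<Rightarrow> real \<Rightarrow> (real \<Rightarrow> 'a) \<Rightarrow> bool" where
  "mean_value_curve X t0 z \<longleftrightarrow> continuous_on {t0..} z \<and>
     (\<forall>u v c B. t0 \<le> u \<and> u \<le> v \<and> 0 \<le> B \<and> (\<forall>t\<in>{u<..<v}. norm (X t (z t) - c) \<le> B) \<longrightarrow>
       norm (z v - z u - (v - u) *\<^sub>R c) \<le> B * (v - u))"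

lemma mean_value_curveD:
  assumes "mean_value_curve X t0 z"
  shows "continuous_on {t0..} z"
    and "\<And>u v c B. t0 \<le> u \<Longrightarrow> u \<le> v \<Longrightarrow> 0 \<le> B \<Longrightarrow>
      (\<And>t. u < t \<Longrightarrow> t < v \<Longrightarrow> norm (X t (z t) - c) \<le> B) \<Longrightarrow> norm (z v - z u - (v - u) *\<^sub>R c) \<le> B * (v - u)"
  using assms unfolding mean_value_curve_def by simp_all

lemma caratheodory_solution_imp_mean_value_curve:
  assumes sol: "caratheodory_solution X t0 x z"
  shows "mean_value_curve X t0 z"
  unfolding mean_value_curve_def
proof (intro conjI allI impI)
  have ac: "absolutely_continuous_on {t0..b} z" if "b \<ge> t0" for b
    using sol that by (simp add: caratheodory_solution_def)
  show "continuous_on {t0..} z"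
    unfolding continuous_on_iff
  proof (intro ballI allI impI)
    fix x e :: real assume x: "x \<in> {t0..}" and e: "e > 0"
    then have "continuous_on {t0..x + 1} z"
      by (intro absolutely_continuous_on_imp_continuous_on ac) simp
    then obtain d where d: "d > 0" "\<And>y. y \<in> {t0..x + 1} \<Longrightarrow> dist y x < d \<Longrightarrow> dist (z y) (z x) < e"
      using x e unfolding continuous_on_iff by force
    show "\<exists>d>0. \<forall>y\<in>{t0..}. dist y x < d \<longrightarrow> dist (z y) (z x) < e"
      using d by (intro exI[of _ "min d 1"]) (auto simp: dist_real_def)
  qed
  have "AE t in lebesgue_on {t0..}. (z has_vector_derivative X t (z t)) (at t)"
    using sol by (simp add: caratheodory_solution_def)
  then have "AE t in lebesgue. t \<in> {t0..} \<longrightarrow> (z has_vector_derivative X t (z t)) (at t)"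
    by (subst (asm) AE_restrict_space_iff) auto
  then obtain N where N: "{t. \<not> (t \<in> {t0..} \<longrightarrow> (z has_vector_derivative X t (z t)) (at t))} \<subseteq> N"
      "emeasure lebesgue N = 0" "N \<in> sets lebesgue"
    by (auto elim!: AE_E)
  fix u v B :: real and c :: 'a
  assume *: "t0 \<le> u \<and> u \<le> v \<and> 0 \<le> B \<and> (\<forall>t\<in>{u<..<v}. norm (X t (z t) - c) \<le> B)"
  have ac': "absolutely_continuous_on {u..v} z"
    using ac[of v] * by (auto intro: absolutely_continuous_on_subset)
  \<comment> \<open>The field is bounded only strictly between \<open>u\<close> and
    \<open>v\<close>, so the endpoints join the exceptional set.\<close>
  have null: "insert u (insert v N) \<in> null_sets lebesgue"
    using N by (simp add: null_setsI)
  show "norm (z v - z u - (v - u) *\<^sub>R c) \<le> B * (v - u)"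
  proof (rule absolutely_continuous_on_mean_value_bound[OF ac' _ _ null])
    fix t assume t: "t \<in> {u..v} - insert u (insert v N)"
    then have "t \<notin> N" "t \<in> {t0..}" using * by auto
    then have "(z has_vector_derivative X t (z t)) (at t)" using N(1) by blast
    then have "(z has_vector_derivative X t (z t)) (at t within {u..v})"
      by (rule has_vector_derivative_at_within)
    then show "\<exists>w'. (z has_vector_derivative w') (at t within {u..v}) \<and> norm (w' - c) \<le> B"
      using t * by fastforce
  qed (use * in auto)
qed

lemma mean_value_curve_shift:
  assumes "mean_value_curve X t0 z" and "t0 \<le> t1 + h"
  shows "mean_value_curve (\<lambda>t. X (t + h)) t1 (\<lambda>t. z (t + h))"
  unfolding mean_value_curve_def
proof (intro conjI allI impI)
  show "continuous_on {t1..} (\<lambda>t. z (t + h))"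
    by (rule continuous_on_compose2[OF mean_value_curveD(1)[OF assms(1)]]) (use assms(2) in \<open>auto intro!: continuous_intros\<close>)
  fix u v B :: real and c :: 'a
  assume *: "t1 \<le> u \<and> u \<le> v \<and> 0 \<le> B \<and> (\<forall>t\<in>{u<..<v}. norm (X (t + h) (z (t + h)) - c) \<le> B)"
  have "norm (X t (z t) - c) \<le> B" if "u + h < t" "t < v + h" for t
    using *[THEN conjunct2, THEN conjunct2, THEN conjunct2, rule_format, of "t - h"] that by simp
  then show "norm (z (v + h) - z (u + h) - (v - u) *\<^sub>R c) \<le> B * (v - u)"
    using mean_value_curveD(2)[OF assms(1), of "u + h" "v + h" B c] * assms(2) by auto
qed

lemma caratheodory_solution_imp_mean_value_curve_0:
  assumes "caratheodory_solution X t0 x z"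
  shows "mean_value_curve (\<lambda>t. X (t + t0)) 0 (\<lambda>t. z (t + t0))"
  using mean_value_curve_shift[OF caratheodory_solution_imp_mean_value_curve[OF assms], of 0 t0] by simp

lemma mean_value_curve_restrict:
  "mean_value_curve X t0 Z \<Longrightarrow> t0 \<le> t1 \<Longrightarrow> mean_value_curve X t1 Z"
  using mean_value_curve_shift[of X t0 Z t1 0] by simp

lemma autonomous_mean_value_curve_has_vector_derivative:
  assumes mv: "mean_value_curve (\<lambda>_. F) t0 y" and F: "continuous_on UNIV F" and t: "t0 < t"
  shows "(y has_vector_derivative F (y t)) (at t)"
proof -
  have y: "continuous_on {t0..} y" by (rule mean_value_curveD(1)[OF mv])
  have "continuous_on {t0<..} (\<lambda>s. F (y s))"
    by (rule continuous_on_compose2[OF F continuous_on_subset[OF y]]) auto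
  then have Fy: "isCont (\<lambda>s. F (y s)) t" using t by (simp add: continuous_on_eq_continuous_at)
  have "\<exists>d>0. \<forall>s. norm (s - t) < d \<longrightarrow> norm (y s - y t - (s - t) *\<^sub>R F (y t)) \<le> e * norm (s - t)" if e: "e > 0" for e
  proof -
    obtain d where d: "d > 0" "\<And>s. dist s t < d \<Longrightarrow> dist (F (y s)) (F (y t)) < e"
      using Fy e unfolding continuous_at_eps_delta by blast
    have bd: "norm (F (y r) - F (y t)) \<le> e" if "\<bar>r - t\<bar> < d" for r
      using d(2)[of r] that by (simp add: dist_norm)
    have "norm (y s - y t - (s - t) *\<^sub>R F (y t)) \<le> e * norm (s - t)" if s: "norm (s - t) < min d (t - t0)" for s
    proof (cases "t \<le> s")
      case True
      then show ?thesis
        using mean_value_curveD(2)[OF mv, of t s e "F (y t)"] bd e t s by simp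
    next
      case False
      then have "norm (y t - y s - (t - s) *\<^sub>R F (y t)) \<le> e * (t - s)"
        using bd e s by (intro mean_value_curveD(2)[OF mv]) auto
      moreover have "y s - y t - (s - t) *\<^sub>R F (y t) = - (y t - y s - (t - s) *\<^sub>R F (y t))"
        by (simp add: algebra_simps)
      ultimately show ?thesis using False by (simp only: norm_minus_cancel) simp
    qed
    then show ?thesis using d(1) t by (intro exI[of _ "min d (t - t0)"]) auto
  qed
  then show ?thesis
    unfolding has_vector_derivative_def has_derivative_at_alt by (auto intro: bounded_linear_scaleR_left)
qed

text \<open>Lyapunov stability is stated for Caratheodory solutions, so shifted nominal curves must
  be turned back into such solutions. The bound on \<open>F\<close> along a compact piece of the
  curve gives Lipschitz continuity there.\<close>

lemma autonomous_mean_value_curve_imp_caratheodory_solution: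
  assumes mv: "mean_value_curve (\<lambda>_. F) t0 y" and F: "continuous_on UNIV F"
  shows "caratheodory_solution (\<lambda>_. F) t0 (y t0) y"
  unfolding caratheodory_solution_def
proof (intro conjI allI impI refl)
  have y: "continuous_on {t0..} y" by (rule mean_value_curveD(1)[OF mv])
  fix b assume "t0 \<le> b"
  have "continuous_on {t0..b} (\<lambda>s. F (y s))"
    by (rule continuous_on_compose2[OF F continuous_on_subset[OF y]]) auto
  then have "bounded ((\<lambda>s. F (y s)) ` {t0..b})"
    by (intro compact_imp_bounded compact_continuous_image) auto
  then obtain M where M: "M > 0" "\<And>s. s \<in> {t0..b} \<Longrightarrow> norm (F (y s)) \<le> M"
    unfolding bounded_pos by auto
  show "absolutely_continuous_on {t0..b} y"
  proof (rule absolutely_continuous_on_Lipschitz)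
    fix u v assume "u \<in> {t0..b}" "v \<in> {t0..b}" "u \<le> v"
    then show "norm (y v - y u) \<le> M * (v - u)"
      using mean_value_curveD(2)[OF mv, of u v M 0] M by auto
  qed (use M in simp)
next
  \<comment> \<open>At \<open>t0\<close> only a one-sided derivative is available, but a single
    point is null.\<close>
  have "AE t in lebesgue. t \<noteq> t0"
    by (rule AE_not_in[of "{t0}", simplified]) simp
  then have "AE t in lebesgue. t \<in> {t0..} \<longrightarrow> (y has_vector_derivative F (y t)) (at t)"
    by eventually_elim (auto intro!: autonomous_mean_value_curve_has_vector_derivative[OF mv F])
  then show "AE t in lebesgue_on {t0..}. (y has_vector_derivative F (y t)) (at t)"
    by (subst AE_restrict_space_iff) auto
qed

subsection \<open>Switching functions\<close>

text \<open>Only the value of \<open>\<tau>\<close> at \<open>s\<close> itself enters, so the slot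
  is found as if \<open>\<tau>\<close> had been equal to \<open>\<theta>\<close> ever since time 0.
  This is why the grid of periods starts at 0.\<close>

lemma sigma_hat_slot:
  fixes j k :: nat
  assumes \<theta>: "\<tau> s = \<theta>" "\<theta> > 0" and k: "1 \<le> k" "k \<le> m"
    and s: "real j * (real m * \<theta>) + real (k - 1) * \<theta> \<le> s" "s < real j * (real m * \<theta>) + real k * \<theta>"
  shows "sigma_hat m \<tau> s = k"
proof -
  have m: "real m * \<theta> > 0" using k \<theta> by simp
  have "real k * \<theta> \<le> real m * \<theta>" "0 \<le> real (k - 1) * \<theta>" using k \<theta> by (auto intro: mult_right_mono)
  then have "real j * (real m * \<theta>) \<le> s" "s < (real j + 1) * (real m * \<theta>)"
    using s by (auto simp: algebra_simps)
  then have "\<lfloor>s / (real m * \<theta>)\<rfloor> = int j"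
    by (intro floor_unique) (simp_all add: pos_le_divide_eq[OF m] pos_divide_less_eq[OF m])
  moreover have "\<lfloor>(s - real m * \<theta> * real j) / \<theta>\<rfloor> = int (k - 1)"
    using s k by (intro floor_unique)
      (simp_all add: pos_le_divide_eq[OF \<theta>(2)] pos_divide_less_eq[OF \<theta>(2)] mult.commute mult.left_commute diff_less_eq le_diff_eq add.commute of_nat_diff)
  ultimately show ?thesis
    using k \<theta> by (simp add: sigma_hat_def)
qed

lemma switching_time_function_step:
  assumes T: "T > 0" and h: "\<And>j. h j > 0" "antimono h" "h \<longlonglongrightarrow> 0"
  shows "switching_time_function T (\<lambda>s. h (nat \<lfloor>s / T\<rfloor>))"
  unfolding switching_time_function_def
proof (intro conjI allI impI)
  show "antimono_on {0..} (\<lambda>s. h (nat \<lfloor>s / T\<rfloor>))"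
    using T by (auto intro!: monotone_onI antimonoD[OF h(2)] nat_mono floor_mono divide_right_mono)
  have "filterlim (\<lambda>s. nat \<lfloor>s / T\<rfloor>) sequentially at_top"
    unfolding filterlim_at_top
  proof
    fix n :: nat
    have "n \<le> nat \<lfloor>s / T\<rfloor>" if "real n * T \<le> s" for s
      using that T by (simp add: le_nat_floor le_divide_eq)
    then show "\<forall>\<^sub>F s in at_top. n \<le> nat \<lfloor>s / T\<rfloor>"
      unfolding eventually_at_top_linorder by blast
  qed
  then show "((\<lambda>s. h (nat \<lfloor>s / T\<rfloor>)) \<longlongrightarrow> 0) at_top"
    by (rule filterlim_compose[OF h(3)])
  fix n :: nat assume "1 \<le> n"
  \<comment> \<open>Constancy intervals are numbered from 1, the terms of \<open>h\<close> from
    0.\<close>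
  have "\<lfloor>s / T\<rfloor> = int n - 1" if "s \<in> {(real n - 1) * T..<real n * T}" for s
    using that T by (intro floor_unique) (auto simp: le_divide_eq divide_less_eq)
  then show "(\<lambda>s. h (nat \<lfloor>s / T\<rfloor>)) constant_on {(real n - 1) * T..<real n * T}"
    unfolding constant_on_def by (metis (no_types, lifting))
qed (rule h(1))

lemma switching_time_function_inverse:
  assumes T: "T > 0" and c: "c > 0"
  shows "switching_time_function T (\<lambda>s. c * inverse (real (Suc (nat \<lfloor>s / T\<rfloor>))))"
proof (rule switching_time_function_step[OF T])
  show "(\<lambda>j. c * inverse (real (Suc j))) \<longlonglongrightarrow> 0"
    using tendsto_mult_right_zero[OF LIMSEQ_inverse_real_of_nat] .
  show "antimono (\<lambda>j. c * inverse (real (Suc j)))"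
    using c by (auto intro!: antimonoI mult_left_mono le_imp_inverse_le)
qed (use c in auto)

subsection \<open>Averaging\<close>

text \<open>The components are only locally Lipschitz, so \<open>L\<close> and \<open>M\<close>
  belong to \<open>S\<close>, and every estimate below assumes that the curves stay in
  \<open>S\<close>. That \<open>F\<close> is the mean of the components is required
  everywhere.\<close>

locale averaged_family =
  fixes m :: nat and G :: "nat \<Rightarrow> 'a \<Rightarrow> 'a::euclidean_space" and F :: "'a \<Rightarrow> 'a"
    and S :: "'a set" and L M :: real
  assumes m: "1 \<le> m" and L: "0 \<le> L" and M: "0 \<le> M"
    and lip: "\<And>k x y. k \<in> {1..m} \<Longrightarrow> x \<in> S \<Longrightarrow> y \<in> S \<Longrightarrow> norm (G k x - G k y) \<le> L * norm (x - y)"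
    and bound: "\<And>k x. k \<in> {1..m} \<Longrightarrow> x \<in> S \<Longrightarrow> norm (G k x) \<le> M"
    and average: "\<And>x. real m *\<^sub>R F x = (\<Sum>k=1..m. G k x)"
begin

lemma average_lip:
  assumes "x \<in> S" "y \<in> S"
  shows "norm (F x - F y) \<le> L * norm (x - y)"
proof -
  have "real m * norm (F x - F y) = norm (real m *\<^sub>R F x - real m *\<^sub>R F y)"
    by (simp flip: scaleR_diff_right)
  also have "\<dots> = norm (\<Sum>k=1..m. G k x - G k y)"
    by (simp add: average sum_subtractf)
  also have "\<dots> \<le> (\<Sum>k=1..m. L * norm (x - y))"
    by (intro sum_norm_le lip assms)
  finally show ?thesis using m by simp
qed

lemma average_bound:
  assumes "x \<in> S"
  shows "norm (F x) \<le> M"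
proof -
  have "real m * norm (F x) = norm (real m *\<^sub>R F x)" by simp
  also have "\<dots> \<le> (\<Sum>k=1..m. M)"
    unfolding average by (intro sum_norm_le bound assms)
  finally show ?thesis using m by simp
qed

lemma switched_speed:
  assumes Z: "mean_value_curve (\<lambda>s. G (sigma_hat m \<tau> s)) t0 Z" and uv: "t0 \<le> u" "u \<le> v"
    and S: "\<And>s. u \<le> s \<Longrightarrow> s \<le> v \<Longrightarrow> Z s \<in> S" and pos: "\<And>s. u < s \<Longrightarrow> s < v \<Longrightarrow> \<tau> s > 0"
  shows "norm (Z v - Z u) \<le> M * (v - u)"
proof -
  have "norm (G (sigma_hat m \<tau> t) (Z t) - 0) \<le> M" if "u < t" "t < v" for t
    using bound[OF sigma_hat_eq_and_range(2), of \<tau> t "Z t"] m S[of t] pos[of t] that by simp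
  then have "norm (Z v - Z u - (v - u) *\<^sub>R 0) \<le> M * (v - u)"
    by (intro mean_value_curveD(2)[OF Z uv M])
  then show ?thesis by simp
qed

lemma averaged_speed:
  assumes Y: "mean_value_curve (\<lambda>_. F) t0 Y" and uv: "t0 \<le> u" "u \<le> v"
    and S: "\<And>s. u \<le> s \<Longrightarrow> s \<le> v \<Longrightarrow> Y s \<in> S"
  shows "norm (Y v - Y u) \<le> M * (v - u)"
  using mean_value_curveD(2)[OF Y uv M, of 0] S average_bound by simp

lemma switched_period:
  fixes j :: nat
  assumes Z: "mean_value_curve (\<lambda>s. G (sigma_hat m \<tau> s)) t0 Z"
    and p: "p = real j * (real m * \<theta>)" "t0 \<le> p" and \<theta>: "\<theta> > 0"
    and \<tau>: "\<And>s. p \<le> s \<Longrightarrow> s < p + real m * \<theta> \<Longrightarrow> \<tau> s = \<theta>"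
    and S: "\<And>s. p \<le> s \<Longrightarrow> s \<le> p + real m * \<theta> \<Longrightarrow> Z s \<in> S"
  shows "norm (Z (p + real m * \<theta>) - Z p - (real m * \<theta>) *\<^sub>R F (Z p)) \<le> L * M * (real m * \<theta>) * (real m * \<theta>)"
proof -
  define P where "P = real m * \<theta>"
  have P: "P > 0" using m \<theta> by (simp add: P_def)
  \<comment> \<open>All components are frozen at the same point \<open>Z p\<close>, not at the
    starts of their slots. Within the period \<open>Z\<close> is at most \<open>M * P\<close> away
    from it, so freezing changes the field by at most \<open>L * M * P\<close>, and the slots add up
    to a multiple of \<open>F (Z p)\<close>.\<close>
  have step: "norm (Z (p + real k * \<theta>) - Z p - \<theta> *\<^sub>R (\<Sum>i=1..k. G i (Z p))) \<le> L * M * P * (real k * \<theta>)"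
    if "k \<le> m" for k
    using that
  proof (induction k)
    case 0
    show ?case by simp
  next
    case (Suc k)
    let ?u = "p + real k * \<theta>" and ?v = "p + real (Suc k) * \<theta>"
    have vP: "?v \<le> p + P" and up: "p \<le> ?u" and uv: "?u \<le> ?v"
      using Suc.prems \<theta> by (auto simp: P_def simp del: of_nat_Suc intro!: mult_right_mono)
    have "norm (Z ?v - Z ?u - (?v - ?u) *\<^sub>R G (Suc k) (Z p)) \<le> (L * (M * P)) * (?v - ?u)"
    proof (rule mean_value_curveD(2)[OF Z])
      fix t assume t: "?u < t" "t < ?v"
      have tp: "p \<le> t" "t < p + P" using t vP up by auto
      have "sigma_hat m \<tau> t = Suc k"
        using Suc.prems t p \<theta> \<tau>[of t] tp by (intro sigma_hat_slot[where \<theta> = \<theta> and j = j]) (auto simp: P_def)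
      moreover have "norm (Z t - Z p) \<le> M * (t - p)"
        using tp p(2) \<theta> \<tau> S by (intro switched_speed[OF Z]) (auto simp: P_def)
      then have "norm (Z t - Z p) \<le> M * P"
        using tp M by (smt (verit) mult_left_mono)
      moreover have "norm (G (Suc k) (Z t) - G (Suc k) (Z p)) \<le> L * norm (Z t - Z p)"
        using Suc.prems tp P by (intro lip S) (auto simp: P_def)
      ultimately show "norm (G (sigma_hat m \<tau> t) (Z t) - G (Suc k) (Z p)) \<le> L * (M * P)"
        using L by (smt (verit) mult_left_mono)
    qed (use p up uv L M P in auto)
    moreover have "norm (Z ?u - Z p - \<theta> *\<^sub>R (\<Sum>i=1..k. G i (Z p))) \<le> L * M * P * (real k * \<theta>)"
      using Suc by simp
    ultimately have "norm ((Z ?v - Z ?u - (?v - ?u) *\<^sub>R G (Suc k) (Z p)) + (Z ?u - Z p - \<theta> *\<^sub>R (\<Sum>i=1..k. G i (Z p))))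
        \<le> (L * (M * P)) * (?v - ?u) + L * M * P * (real k * \<theta>)"
      by (rule norm_triangle_mono)
    then show ?case by (simp add: algebra_simps)
  qed
  have "\<theta> *\<^sub>R (\<Sum>i=1..m. G i (Z p)) = P *\<^sub>R F (Z p)"
    by (simp only: average[symmetric]) (simp add: P_def mult.commute)
  then show ?thesis using step[of m] by (simp add: P_def)
qed

lemma averaged_period:
  assumes Y: "mean_value_curve (\<lambda>_. F) t0 Y" and p: "t0 \<le> p" and P: "P \<ge> 0"
    and S: "\<And>s. p \<le> s \<Longrightarrow> s \<le> p + P \<Longrightarrow> Y s \<in> S"
  shows "norm (Y (p + P) - Y p - P *\<^sub>R F (Y p)) \<le> L * M * P * P"
proof -
  have "norm (Y (p + P) - Y p - ((p + P) - p) *\<^sub>R F (Y p)) \<le> L * (M * P) * ((p + P) - p)"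
  proof (rule mean_value_curveD(2)[OF Y])
    fix t assume t: "p < t" "t < p + P"
    have "norm (Y t - Y p) \<le> M * (t - p)"
      using t p S by (intro averaged_speed[OF Y]) auto
    also have "\<dots> \<le> M * P" using t M by (intro mult_left_mono) auto
    finally have "L * norm (Y t - Y p) \<le> L * (M * P)" using L by (rule mult_left_mono)
    moreover have "norm (F (Y t) - F (Y p)) \<le> L * norm (Y t - Y p)"
      using t by (intro average_lip S) auto
    ultimately show "norm (F (Y t) - F (Y p)) \<le> L * (M * P)" by simp
  qed (use p P L M in auto)
  then show ?thesis by (simp add: mult_ac)
qed

text \<open>The term \<open>4 * M\<close> comes from the incomplete periods at both ends, \<open>2 * M\<close> from each.\<close>

lemma switched_averaged_interval:
  assumes Z: "mean_value_curve (\<lambda>s. G (sigma_hat m \<tau> s)) t0 Z" and Y: "mean_value_curve (\<lambda>_. F) t0 Y"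
    and a: "0 \<le> a" "t0 \<le> a" "a \<le> b" and \<theta>: "\<theta> > 0" and \<tau>: "\<And>s. a \<le> s \<Longrightarrow> s < b \<Longrightarrow> \<tau> s = \<theta>"
    and ZS: "\<And>s. a \<le> s \<Longrightarrow> s \<le> b \<Longrightarrow> Z s \<in> S" and YS: "\<And>s. a \<le> s \<Longrightarrow> s \<le> b \<Longrightarrow> Y s \<in> S"
  shows "norm (Z b - Y b) \<le> exp (L * (b - a)) * (norm (Z a - Y a) + (4 * M + 2 * L * M * (b - a)) * (real m * \<theta>))"
proof -
  define P where "P = real m * \<theta>"
  have P: "P > 0" using m \<theta> by (simp add: P_def)
  define e where "e s = norm (Z s - Y s)" for s
  \<comment> \<open>The crude bound through the speeds of both curves, for use on incomplete
    periods.\<close>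
  have speed: "e v \<le> e u + 2 * M * (v - u)" if "a \<le> u" "u \<le> v" "v \<le> b" for u v
  proof -
    have "norm (Z v - Z u) \<le> M * (v - u)" "norm (Y v - Y u) \<le> M * (v - u)"
      using that a \<theta> \<tau> ZS YS by (auto intro!: switched_speed[OF Z] averaged_speed[OF Y])
    moreover have "e v = norm ((Z u - Y u) + ((Z v - Z u) - (Y v - Y u)))" by (simp add: e_def)
    moreover have "\<dots> \<le> e u + (norm (Z v - Z u) + norm (Y v - Y u))"
      unfolding e_def by (intro norm_triangle_mono norm_triangle_ineq4 order_refl)
    ultimately show ?thesis by simp
  qed
  have period: "e (p + P) \<le> (1 + L * P) * e p + 2 * L * M * P * P"
    if p: "a \<le> p" "p + P \<le> b" "p = real j * P" for p and j :: nat
  proof -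
    have "norm (Z (p + P) - Z p - P *\<^sub>R F (Z p)) \<le> L * M * P * P"
      using p a \<theta> \<tau> ZS unfolding P_def by (intro switched_period[OF Z]) auto
    moreover have "norm (Y (p + P) - Y p - P *\<^sub>R F (Y p)) \<le> L * M * P * P"
      using p a P YS by (intro averaged_period[OF Y]) auto
    moreover have "norm (F (Z p) - F (Y p)) \<le> L * e p"
      unfolding e_def using p P ZS YS by (intro average_lip) auto
    then have "norm (P *\<^sub>R (F (Z p) - F (Y p))) \<le> P * (L * e p)"
      using P by (simp add: mult_left_mono)
    moreover have "e (p + P) = norm ((Z p - Y p) + P *\<^sub>R (F (Z p) - F (Y p))
        + ((Z (p + P) - Z p - P *\<^sub>R F (Z p)) - (Y (p + P) - Y p - P *\<^sub>R F (Y p))))"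
      by (simp add: e_def algebra_simps)
    moreover have "\<dots> \<le> e p + norm (P *\<^sub>R (F (Z p) - F (Y p)))
        + (norm (Z (p + P) - Z p - P *\<^sub>R F (Z p)) + norm (Y (p + P) - Y p - P *\<^sub>R F (Y p)))"
      unfolding e_def by (intro norm_triangle_mono norm_triangle_ineq4 order_refl)
    ultimately show ?thesis by (simp add: algebra_simps)
  qed
  have exp_mono1: "c \<le> exp x * c" if "0 \<le> x" "0 \<le> c" for x c :: real
    using mult_right_mono[of 1 "exp x" c] that by simp
  \<comment> \<open>The first grid point not before \<open>a\<close>. Rounding up loses less than
    one period, and \<open>0 \<le> a\<close> makes the ceiling a natural number.\<close>
  define j0 where "j0 = nat \<lceil>a / P\<rceil>"
  define q where "q i = real (j0 + i) * P" for i :: nat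
  have j0: "a \<le> real j0 * P" "real j0 * P < a + P"
  proof -
    have "0 \<le> a / P" using a P by simp
    then have "real j0 = of_int \<lceil>a / P\<rceil>" by (simp add: j0_def)
    then have "a / P \<le> real j0" "real j0 < a / P + 1" by linarith+
    then show "a \<le> real j0 * P" "real j0 * P < a + P" using P by (simp_all add: field_simps)
  qed
  have eb: "e b \<le> exp (L * (b - a)) * (e a + (2 * M + 2 * L * M * (b - a)) * P) + 2 * M * P"
  proof (cases "b < real j0 * P")
    \<comment> \<open>No grid point lies in \<open>{a..b}\<close>, so the interval is shorter than a
      period and the crude bound is enough.\<close>
    case True
    have "e b \<le> e a + 2 * M * (b - a)" using speed a by simp
    also have "\<dots> \<le> e a + 2 * M * P"
      using True j0 M by (intro add_left_mono mult_left_mono) auto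
    also have "\<dots> \<le> 1 * (e a + (2 * M + 2 * L * M * (b - a)) * P) + 2 * M * P"
    proof -
      have "0 \<le> M * P" "0 \<le> L * M * (b - a) * P" using L M P a by auto
      then show ?thesis by (simp add: algebra_simps)
    qed
    also have "\<dots> \<le> exp (L * (b - a)) * (e a + (2 * M + 2 * L * M * (b - a)) * P) + 2 * M * P"
      using L M P a by (intro add_right_mono mult_right_mono) (auto simp: e_def)
    finally show ?thesis .
  next
    case False
    \<comment> \<open>Discrete Gronwall: \<open>1 + L * P\<close> is at most
      \<open>exp (L * P)\<close>, and the defects \<open>2 * L * M * P * P\<close> of the single
      periods are collected inside the bracket.\<close>
    have grid: "e (q i) \<le> exp (L * (real i * P)) * (e a + 2 * M * P + 2 * L * M * P * (real i * P))"
      if "q i \<le> b" for i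
      using that
    proof (induction i)
      case 0
      have "e (q 0) \<le> e a + 2 * M * (q 0 - a)"
        using j0 0 by (intro speed) (auto simp: q_def)
      also have "\<dots> \<le> e a + 2 * M * P"
        using j0 M by (intro add_left_mono mult_left_mono) (auto simp: q_def)
      finally show ?case by simp
    next
      case (Suc i)
      have qS: "q (Suc i) = q i + P" by (simp add: q_def algebra_simps)
      have qa: "a \<le> q i" using j0 P by (simp add: q_def algebra_simps add_increasing)
      have IH: "e (q i) \<le> exp (L * (real i * P)) * (e a + 2 * M * P + 2 * L * M * P * (real i * P))"
        using Suc P by (simp add: qS)
      have "e (q (Suc i)) \<le> (1 + L * P) * e (q i) + 2 * L * M * P * P"
        unfolding qS by (rule period[OF qa, of "j0 + i"]) (use Suc.prems qS in \<open>simp_all add: q_def\<close>)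
      also have "\<dots> \<le> exp (L * P) * e (q i) + exp (L * (real (Suc i) * P)) * (2 * L * M * P * P)"
        using L M P by (intro add_mono mult_right_mono exp_mono1) (auto simp: e_def exp_ge_add_one_self)
      also have "\<dots> \<le> exp (L * P) * (exp (L * (real i * P)) * (e a + 2 * M * P + 2 * L * M * P * (real i * P)))
          + exp (L * (real (Suc i) * P)) * (2 * L * M * P * P)"
        by (intro add_right_mono mult_left_mono IH) simp
      also have "\<dots> = exp (L * (real (Suc i) * P)) * (e a + 2 * M * P + 2 * L * M * P * (real (Suc i) * P))"
      proof -
        have "exp (L * P) * exp (L * (real i * P)) = exp (L * (real (Suc i) * P))"
          by (simp add: algebra_simps flip: exp_add)
        then show ?thesis unfolding mult.assoc[symmetric] by (simp add: algebra_simps)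
      qed
      finally show ?case .
    qed
    define i where "i = nat \<lfloor>(b - real j0 * P) / P\<rfloor>"
    have "0 \<le> (b - real j0 * P) / P" using False P by simp
    then have "real i = of_int \<lfloor>(b - real j0 * P) / P\<rfloor>" by (simp add: i_def)
    then have "real i \<le> (b - real j0 * P) / P" "(b - real j0 * P) / P < real i + 1" by linarith+
    then have i: "q i \<le> b" "b < q i + P" using P by (simp_all add: q_def field_simps)
    have qa: "a \<le> q i" using j0 P by (simp add: q_def algebra_simps add_increasing)
    have iP: "0 \<le> real i * P" "real i * P \<le> b - a" using i j0 P by (auto simp: q_def algebra_simps)
    have "e b \<le> e (q i) + 2 * M * (b - q i)" using qa i by (intro speed) auto
    also have "\<dots> \<le> exp (L * (real i * P)) * (e a + 2 * M * P + 2 * L * M * P * (real i * P)) + 2 * M * P"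
      using i M by (intro add_mono mult_left_mono grid) auto
    also have "\<dots> \<le> exp (L * (b - a)) * (e a + 2 * M * P + 2 * L * M * P * (b - a)) + 2 * M * P"
      using iP L M P by (intro add_right_mono mult_mono add_left_mono mult_left_mono) (auto simp: e_def intro!: mult_left_mono)
    finally show ?thesis by (simp add: algebra_simps)
  qed
  \<comment> \<open>The last incomplete period moves under the exponential and joins the first
    one.\<close>
  also have "\<dots> \<le> exp (L * (b - a)) * (e a + (2 * M + 2 * L * M * (b - a)) * P) + exp (L * (b - a)) * (2 * M * P)"
    using L M P a by (intro add_left_mono exp_mono1) auto
  finally show ?thesis by (simp add: e_def P_def algebra_simps)
qed

end

text \<open>Each constancy interval multiplies the error by at most \<open>exp (L * T)\<close> and
  adds a share proportional to its switching time, which by monotonicity is at most that at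
  \<open>real n * T\<close>. The time \<open>b\<close> is separate from the end of the horizon
  because a bootstrap knows the curves to lie in \<open>S\<close> only up to the present
  time.\<close>

lemma (in averaged_family) switched_averaged_horizon:
  fixes n N :: nat
  assumes \<tau>: "switching_time_function T \<tau>" and T: "T > 0"
    and Z: "mean_value_curve (\<lambda>s. G (sigma_hat m \<tau> s)) (real n * T) Z"
    and Y: "mean_value_curve (\<lambda>_. F) (real n * T) Y"
    and S: "\<And>s. real n * T \<le> s \<Longrightarrow> s \<le> b \<Longrightarrow> Z s \<in> S \<and> Y s \<in> S"
    and s: "real n * T \<le> s" "s \<le> b" "s \<le> real (n + N) * T"
  shows "norm (Z s - Y s) \<le> exp (L * T * real N) *
    (norm (Z (real n * T) - Y (real n * T)) + real N * ((4 * M + 2 * L * M * T) * (real m * \<tau> (real n * T))))"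
  using s
proof (induction N arbitrary: s)
  case 0
  then show ?case by simp
next
  case (Suc i)
  define D where "D = (4 * M + 2 * L * M * T) * (real m * \<tau> (real n * T))"
  define e where "e s = norm (Z s - Y s)" for s
  define E where "E = e (real n * T) + real i * D"
  have \<tau>pos: "\<tau> s > 0" if "s \<ge> 0" for s using \<tau> that by (simp add: switching_time_function_def)
  have D: "D \<ge> 0" using L M T \<tau>pos[of "real n * T"] by (simp add: D_def)
  have E: "E \<ge> 0" using D by (simp add: E_def e_def)
  have IH: "e s \<le> exp (L * T * real i) * E" if "real n * T \<le> s" "s \<le> b" "s \<le> real (n + i) * T" for s
    using Suc.IH[OF that] by (simp add: e_def E_def D_def)
  have "e s \<le> exp (L * T) * (exp (L * T * real i) * E + D)"
  proof (cases "s \<le> real (n + i) * T")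
    case True
    have "e s \<le> 1 * (exp (L * T * real i) * E + 0)" using IH[OF Suc.prems(1,2) True] by simp
    also have "\<dots> \<le> exp (L * T) * (exp (L * T * real i) * E + D)"
      using L T D E by (intro mult_mono add_left_mono) auto
    finally show ?thesis .
  next
    case False
    define a where "a = real (n + i) * T"
    have na: "real n * T \<le> a" "0 \<le> a" using T by (simp_all add: a_def)
    have as: "a \<le> s" "s \<le> a + T" using False Suc.prems by (simp_all add: a_def algebra_simps)
    \<comment> \<open>The interval that starts at \<open>a\<close> has number
      \<open>n + i + 1\<close>, as the numbering begins at 1.\<close>
    have "\<tau> constant_on {(real (n + i + 1) - 1) * T..<real (n + i + 1) * T}"
      using \<tau> unfolding switching_time_function_def by (metis le_add2)
    then obtain \<theta> where \<theta>: "\<And>r. a \<le> r \<Longrightarrow> r < a + T \<Longrightarrow> \<tau> r = \<theta>"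
      unfolding constant_on_def by (force simp: a_def algebra_simps)
    have \<theta>a: "\<theta> = \<tau> a" using \<theta>[of a] T by simp
    have "\<theta> \<le> \<tau> (real n * T)"
      using \<tau> na T unfolding \<theta>a switching_time_function_def by (auto elim!: monotone_onD)
    then have D': "(4 * M + 2 * L * M * (s - a)) * (real m * \<theta>) \<le> D"
      unfolding D_def using as L M T \<tau>pos[OF na(2)] by (intro mult_mono add_left_mono) (auto simp: \<theta>a mult_left_mono)
    have "e s \<le> exp (L * (s - a)) * (e a + (4 * M + 2 * L * M * (s - a)) * (real m * \<theta>))"
      unfolding e_def using na as \<tau>pos[OF na(2)] S Suc.prems
      by (intro switched_averaged_interval[OF Z Y]) (auto simp: \<theta>a intro!: \<theta>[unfolded \<theta>a])
    also have "\<dots> \<le> exp (L * T) * (e a + D)"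
      using D' as L D M \<tau>pos[OF na(2)] by (intro mult_mono add_left_mono) (auto simp: e_def \<theta>a mult_left_mono)
    also have "\<dots> \<le> exp (L * T) * (exp (L * T * real i) * E + D)"
      using IH[of a] na as Suc.prems by (intro mult_left_mono add_right_mono) (auto simp: a_def)
    finally show ?thesis .
  qed
  also have "\<dots> \<le> exp (L * T) * (exp (L * T * real i) * E + exp (L * T * real i) * D)"
    using mult_right_mono[of 1 "exp (L * T * real i)" D] L T D by (intro mult_left_mono add_left_mono) auto
  also have "\<dots> = exp (L * T * real (Suc i)) * (E + D)"
    by (simp add: algebra_simps exp_add)
  finally show ?case by (simp add: e_def E_def D_def algebra_simps)
qed

text \<open>Resolves a circularity: error estimates need the curves confined, and they are confined
  only while the error is small. At the first time with \<open>e\<close> at least \<open>c\<close>,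
  no earlier value exceeds \<open>c\<close>, so \<open>step\<close> gives a contradiction.\<close>

lemma continuous_bootstrap:
  fixes e :: "real \<Rightarrow> real"
  assumes cont: "continuous_on {a..b} e" and a: "e a < c"
    and step: "\<And>s. a \<le> s \<Longrightarrow> s \<le> b \<Longrightarrow> (\<And>r. a \<le> r \<Longrightarrow> r \<le> s \<Longrightarrow> e r \<le> c) \<Longrightarrow> e s < c"
    and s: "a \<le> s" "s \<le> b"
  shows "e s < c"
proof (rule ccontr)
  assume "\<not> e s < c"
  define K where "K = {a..b} \<inter> e -` {c..}"
  have "s \<in> K" using s \<open>\<not> e s < c\<close> by (simp add: K_def)
  moreover have "compact K"
    unfolding K_def compact_eq_bounded_closed
    by (auto intro!: continuous_closed_preimage[OF cont] intro: bounded_subset[OF bounded_closed_interval])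
  ultimately obtain u where u: "u \<in> K" "\<And>r. r \<in> K \<Longrightarrow> u \<le> r"
    using compact_attains_inf[of K] by blast
  then have au: "a \<le> u" "u \<le> b" "c \<le> e u" by (auto simp: K_def)
  obtain v where v: "a \<le> v" "v \<le> u" "e v = c"
    using IVT'[of e a c u] a au continuous_on_subset[OF cont, of "{a..u}"] by auto
  then have "u = v" using u(2)[of v] au by (auto simp: K_def)
  have "e r \<le> c" if "a \<le> r" "r \<le> u" for r
    using u(2)[of r] that au \<open>u = v\<close> v by (cases "e r \<le> c") (auto simp: K_def)
  then show False using step[OF au(1,2)] au(3) by simp
qed

text \<open>\<open>local_lipschitz\<close> is a notion for time-dependent fields; the one-point time
  set reduces it to local Lipschitz continuity in space. Compactness turns this into constants
  common to the finite family.\<close>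

lemma local_lipschitz_family_constants:
  fixes G :: "'i \<Rightarrow> 'a \<Rightarrow> 'a::euclidean_space"
  assumes I: "finite I" and lip: "\<And>k. k \<in> I \<Longrightarrow> local_lipschitz {0::real} UNIV (\<lambda>_. G k)" and S: "compact S"
  obtains L M where "0 \<le> L" "0 \<le> M"
    "\<And>k x y. k \<in> I \<Longrightarrow> x \<in> S \<Longrightarrow> y \<in> S \<Longrightarrow> norm (G k x - G k y) \<le> L * norm (x - y)"
    "\<And>k x. k \<in> I \<Longrightarrow> x \<in> S \<Longrightarrow> norm (G k x) \<le> M"
proof -
  have "\<exists>l. l-lipschitz_on S (G k)" if "k \<in> I" for k
  proof -
    have "local_lipschitz {0::real} S (\<lambda>_. G k)"
      by (rule local_lipschitz_subset[OF lip[OF that]]) auto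
    then obtain l where "\<And>t::real. t \<in> {0} \<Longrightarrow> l-lipschitz_on S (G k)"
      by (rule local_lipschitz_compact_implies_lipschitz[OF _ S]) auto
    then show ?thesis by blast
  qed
  then obtain l where l: "\<And>k. k \<in> I \<Longrightarrow> (l k)-lipschitz_on S (G k)" by metis
  have "\<exists>M. \<forall>x\<in>S. norm (G k x) \<le> M" if "k \<in> I" for k
    using compact_imp_bounded[OF compact_continuous_image[OF lipschitz_on_continuous_on[OF l[OF that]] S]]
    by (auto simp: bounded_iff)
  then obtain M where M: "\<And>k x. k \<in> I \<Longrightarrow> x \<in> S \<Longrightarrow> norm (G k x) \<le> M k" by metis
  show thesis
  proof
    show "0 \<le> (\<Sum>k\<in>I. \<bar>l k\<bar>)" "0 \<le> (\<Sum>k\<in>I. \<bar>M k\<bar>)" by (auto intro: sum_nonneg)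
    fix k x assume k: "k \<in> I" and x: "x \<in> S"
    have "norm (G k x) \<le> \<bar>M k\<bar>" using M[OF k x] by simp
    also have "\<dots> \<le> (\<Sum>k\<in>I. \<bar>M k\<bar>)" using I k by (intro member_le_sum) auto
    finally show "norm (G k x) \<le> (\<Sum>k\<in>I. \<bar>M k\<bar>)" .
    fix y assume y: "y \<in> S"
    have "norm (G k x - G k y) \<le> l k * norm (x - y)"
      using lipschitz_onD[OF l[OF k] x y] by (simp add: dist_norm)
    also have "\<dots> \<le> (\<Sum>k\<in>I. \<bar>l k\<bar>) * norm (x - y)"
    proof (rule mult_right_mono)
      have "l k \<le> \<bar>l k\<bar>" by simp
      also have "\<dots> \<le> (\<Sum>k\<in>I. \<bar>l k\<bar>)" using I k by (intro member_le_sum) auto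
      finally show "l k \<le> (\<Sum>k\<in>I. \<bar>l k\<bar>)" .
    qed simp
    finally show "norm (G k x - G k y) \<le> (\<Sum>k\<in>I. \<bar>l k\<bar>) * norm (x - y)" .
  qed
qed

text \<open>The point is the order of quantifiers: \<open>\<rho>\<close> and \<open>\<eta>\<close>
  are chosen before \<open>n\<close>, the schedule and the curves. Only the bound \<open>R\<close>
  and the number \<open>N\<close> of constancy intervals enter.\<close>

lemma averaging_closeness:
  fixes G :: "nat \<Rightarrow> 'a \<Rightarrow> 'a::euclidean_space" and N :: nat
  assumes m: "1 \<le> m" and T: "T > 0" and \<epsilon>: "\<epsilon> > 0"
    and lip: "\<And>k. k \<in> {1..m} \<Longrightarrow> local_lipschitz {0::real} UNIV (\<lambda>_. G k)"
    and average: "\<And>x. real m *\<^sub>R F x = (\<Sum>k=1..m. G k x)"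
  obtains \<rho> \<eta> where "\<rho> > 0" "\<eta> > 0"
    "\<And>n \<tau> Z Y s. switching_time_function T \<tau> \<Longrightarrow> \<tau> (real n * T) \<le> \<eta> \<Longrightarrow>
      mean_value_curve (\<lambda>s. G (sigma_hat m \<tau> s)) (real n * T) Z \<Longrightarrow>
      mean_value_curve (\<lambda>_. F) (real n * T) Y \<Longrightarrow>
      (\<And>s. real n * T \<le> s \<Longrightarrow> s \<le> real (n + N) * T \<Longrightarrow> norm (Y s) \<le> R) \<Longrightarrow>
      norm (Z (real n * T) - Y (real n * T)) \<le> \<rho> \<Longrightarrow>
      real n * T \<le> s \<Longrightarrow> s \<le> real (n + N) * T \<Longrightarrow> norm (Z s - Y s) < \<epsilon>"
proof -
  obtain L M where LM: "0 \<le> L" "0 \<le> M"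
    "\<And>k x y. k \<in> {1..m} \<Longrightarrow> x \<in> cball 0 (R + 1) \<Longrightarrow> y \<in> cball 0 (R + 1) \<Longrightarrow> norm (G k x - G k y) \<le> L * norm (x - y)"
    "\<And>k x. k \<in> {1..m} \<Longrightarrow> x \<in> cball 0 (R + 1) \<Longrightarrow> norm (G k x) \<le> M"
    using local_lipschitz_family_constants[OF finite_atLeastAtMost lip compact_cball, of 1 m "\<lambda>k. k" 0 "R + 1"] by auto
  interpret averaged_family m G F "cball 0 (R + 1)" L M
    using m LM average by unfold_locales auto
  \<comment> \<open>The cap at 1 keeps \<open>Z\<close> in the ball of radius \<open>R + 1\<close>,
    for which \<open>L\<close> and \<open>M\<close> were obtained.\<close>
  define \<epsilon>' where "\<epsilon>' = min \<epsilon> 1"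
  have \<epsilon>': "\<epsilon>' > 0" "\<epsilon>' \<le> \<epsilon>" "\<epsilon>' \<le> 1" using \<epsilon> by (auto simp: \<epsilon>'_def)
  define K where "K = exp (L * T * real N)"
  have K: "K \<ge> 1" using L T by (simp add: K_def)
  define C where "C = real N * ((4 * M + 2 * L * M * T) * real m)"
  have C: "C \<ge> 0" using L M T by (simp add: C_def)
  \<comment> \<open>Initial error and switching error each get a quarter of
    \<open>\<epsilon>'\<close>, which leaves room for a strict inequality. \<open>C + 1\<close>
    covers \<open>C = 0\<close>.\<close>
  define \<rho> where "\<rho> = \<epsilon>' / (4 * K)"
  define \<eta> where "\<eta> = \<epsilon>' / (4 * K * (C + 1))"
  have \<rho>: "\<rho> > 0" "K * \<rho> = \<epsilon>' / 4" using \<epsilon>' K by (auto simp: \<rho>_def)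
  have \<eta>: "\<eta> > 0" using \<epsilon>' K C by (auto simp: \<eta>_def)
  have "K * ((C + 1) * \<eta>) = \<epsilon>' / 4" using K C by (simp add: \<eta>_def)
  moreover have "K * (C * \<eta>) \<le> K * ((C + 1) * \<eta>)" using K \<eta> by (intro mult_left_mono mult_right_mono) auto
  ultimately have C\<eta>: "K * (C * \<eta>) \<le> \<epsilon>' / 4" by simp
  show thesis
  proof (rule that[OF \<rho>(1) \<eta>])
    fix n :: nat and \<tau> Z Y s
    assume \<tau>: "switching_time_function T \<tau>" "\<tau> (real n * T) \<le> \<eta>"
      and Z: "mean_value_curve (\<lambda>s. G (sigma_hat m \<tau> s)) (real n * T) Z"
      and Y: "mean_value_curve (\<lambda>_. F) (real n * T) Y"
      and R: "\<And>s. real n * T \<le> s \<Longrightarrow> s \<le> real (n + N) * T \<Longrightarrow> norm (Y s) \<le> R"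
      and start: "norm (Z (real n * T) - Y (real n * T)) \<le> \<rho>"
      and s: "real n * T \<le> s" "s \<le> real (n + N) * T"
    have "norm (Z s - Y s) < \<epsilon>'"
    proof (rule continuous_bootstrap[OF _ _ _ s])
      show "continuous_on {real n * T..real (n + N) * T} (\<lambda>s. norm (Z s - Y s))"
        by (intro continuous_intros continuous_on_subset[OF mean_value_curveD(1)[OF Z]]
            continuous_on_subset[OF mean_value_curveD(1)[OF Y]]) auto
      have "1 * \<rho> \<le> \<epsilon>' / 4" using mult_right_mono[OF K, of \<rho>] \<rho>(1) unfolding \<rho>(2) by simp
      then show "norm (Z (real n * T) - Y (real n * T)) < \<epsilon>'" using start \<epsilon>' by linarith
      fix b assume b: "real n * T \<le> b" "b \<le> real (n + N) * T"
        and close: "\<And>r. real n * T \<le> r \<Longrightarrow> r \<le> b \<Longrightarrow> norm (Z r - Y r) \<le> \<epsilon>'"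
      have "Z r \<in> cball 0 (R + 1) \<and> Y r \<in> cball 0 (R + 1)" if "real n * T \<le> r" "r \<le> b" for r
      proof -
        have "norm (Z r) \<le> norm (Y r) + norm (Z r - Y r)" by (rule norm_triangle_sub)
        then show ?thesis using R[of r] close[OF that] that b \<epsilon>' by auto
      qed
      then have "norm (Z b - Y b) \<le> K * (norm (Z (real n * T) - Y (real n * T)) +
          real N * ((4 * M + 2 * L * M * T) * (real m * \<tau> (real n * T))))"
        unfolding K_def using b by (intro switched_averaged_horizon[OF \<tau>(1) T Z Y, where b = b]) auto
      also have "\<dots> = K * (norm (Z (real n * T) - Y (real n * T)) + C * \<tau> (real n * T))"
        by (simp add: C_def algebra_simps)
      also have "\<dots> \<le> K * (\<rho> + C * \<eta>)"
        using K C start \<tau>(2) by (intro mult_left_mono add_mono) auto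
      also have "\<dots> \<le> \<epsilon>' / 2" using C\<eta> \<rho>(2) by (simp add: distrib_left)
      finally show "norm (Z b - Y b) < \<epsilon>'" using \<epsilon>' by simp
    qed
    then show "norm (Z s - Y s) < \<epsilon>" using \<epsilon>' by simp
  qed
qed

text \<open>The case \<open>m = 1\<close> of averaging, with an arbitrary switching function.\<close>

lemma autonomous_continuous_dependence:
  fixes F :: "'a \<Rightarrow> 'a::euclidean_space" and N :: nat
  assumes lip: "local_lipschitz {0::real} UNIV (\<lambda>_. F)" and T: "T > 0" and \<epsilon>: "\<epsilon> > 0"
  obtains \<rho> where "\<rho> > 0"
    "\<And>Z Y s. mean_value_curve (\<lambda>_. F) 0 Z \<Longrightarrow> mean_value_curve (\<lambda>_. F) 0 Y \<Longrightarrow>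
      (\<And>s. 0 \<le> s \<Longrightarrow> s \<le> real N * T \<Longrightarrow> norm (Y s) \<le> R) \<Longrightarrow> norm (Z 0 - Y 0) \<le> \<rho> \<Longrightarrow>
      0 \<le> s \<Longrightarrow> s \<le> real N * T \<Longrightarrow> norm (Z s - Y s) < \<epsilon>"
proof -
  obtain \<rho> \<eta> where \<rho>: "\<rho> > 0" and \<eta>: "\<eta> > 0" and close:
    "\<And>n \<tau> Z Y s. switching_time_function T \<tau> \<Longrightarrow> \<tau> (real n * T) \<le> \<eta> \<Longrightarrow>
      mean_value_curve (\<lambda>s. F) (real n * T) Z \<Longrightarrow>
      mean_value_curve (\<lambda>_. F) (real n * T) Y \<Longrightarrow>
      (\<And>s. real n * T \<le> s \<Longrightarrow> s \<le> real (n + N) * T \<Longrightarrow> norm (Y s) \<le> R) \<Longrightarrow>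
      norm (Z (real n * T) - Y (real n * T)) \<le> \<rho> \<Longrightarrow>
      real n * T \<le> s \<Longrightarrow> s \<le> real (n + N) * T \<Longrightarrow> norm (Z s - Y s) < \<epsilon>"
    using averaging_closeness[of 1 T \<epsilon> "\<lambda>_. F" F N R] lip T \<epsilon> by auto
  \<comment> \<open>With a constant family every schedule produces \<open>F\<close>. The schedule
    supplied here has the value \<open>\<eta>\<close> at time 0.\<close>
  from close[OF switching_time_function_inverse[OF T \<eta>], of 0] show thesis
    by (intro that[OF \<rho>]) auto
qed

subsection \<open>The nominal flow\<close>

definition curve_stable :: "('a \<Rightarrow> 'a::euclidean_space) \<Rightarrow> bool" where
  "curve_stable F \<longleftrightarrow> (\<forall>\<epsilon>>0. \<exists>\<delta>>0. \<forall>Y. mean_value_curve (\<lambda>_. F) 0 Y \<and> norm (Y 0) < \<delta> \<longrightarrow> (\<forall>t\<ge>0. norm (Y t) < \<epsilon>))"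

lemma lyapunov_stable_imp_curve_stable:
  fixes F :: "'a \<Rightarrow> 'a::euclidean_space"
  assumes stable: "lyapunov_stable F t0 0" and F: "continuous_on UNIV F"
  shows "curve_stable F"
  unfolding curve_stable_def
proof (intro allI impI)
  fix \<epsilon> :: real assume "\<epsilon> > 0"
  then obtain \<delta> where \<delta>: "\<delta> > 0" "\<forall>x z. dist x 0 < \<delta> \<and> caratheodory_solution (\<lambda>t. F) t0 x z \<longrightarrow>
      (\<forall>t\<ge>t0. dist (z t) 0 < \<epsilon>)"
    using stable unfolding lyapunov_stable_def by blast
  have "norm (Y t) < \<epsilon>" if Y: "mean_value_curve (\<lambda>_. F) 0 Y" "norm (Y 0) < \<delta>" and t: "t \<ge> 0" for Y t
  proof -
    have "mean_value_curve (\<lambda>_. F) t0 (\<lambda>t. Y (t - t0))"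
      using mean_value_curve_shift[OF Y(1), of t0 "- t0"] by simp
    from autonomous_mean_value_curve_imp_caratheodory_solution[OF this F]
    have "caratheodory_solution (\<lambda>_. F) t0 (Y 0) (\<lambda>t. Y (t - t0))" by simp
    from \<delta>(2)[rule_format, OF conjI[OF _ this], of "t + t0"] show ?thesis using Y(2) t by simp
  qed
  then show "\<exists>\<delta>>0. \<forall>Y. mean_value_curve (\<lambda>_. F) 0 Y \<and> norm (Y 0) < \<delta> \<longrightarrow> (\<forall>t\<ge>0. norm (Y t) < \<epsilon>)"
    using \<delta>(1) by blast
qed

text \<open>Translation invariance lets smallness be tested at any time \<open>h\<close>: a curve
  that comes close to 0 once is trapped from then on.\<close>

lemma curve_stableE:
  assumes "curve_stable F" and "\<epsilon> > 0"
  obtains \<delta> where "\<delta> > 0"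
    "\<And>h Y t. mean_value_curve (\<lambda>_. F) 0 Y \<Longrightarrow> 0 \<le> h \<Longrightarrow> norm (Y h) < \<delta> \<Longrightarrow> h \<le> t \<Longrightarrow> norm (Y t) < \<epsilon>"
proof -
  obtain \<delta> where \<delta>: "\<delta> > 0"
    "\<And>Y t. mean_value_curve (\<lambda>_. F) 0 Y \<Longrightarrow> norm (Y 0) < \<delta> \<Longrightarrow> 0 \<le> t \<Longrightarrow> norm (Y t) < \<epsilon>"
    using assms unfolding curve_stable_def by blast
  have "norm (Y t) < \<epsilon>"
    if "mean_value_curve (\<lambda>_. F) 0 Y" "0 \<le> h" "norm (Y h) < \<delta>" "h \<le> t" for h Y t
    using \<delta>(2)[OF mean_value_curve_shift[OF that(1), of 0 h], of "t - h"] that by simp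
  then show thesis by (intro that[OF \<delta>(1)])
qed

definition curve_attractive :: "('a \<Rightarrow> 'a::euclidean_space) \<Rightarrow> 'a set \<Rightarrow> bool" where
  "curve_attractive F A \<longleftrightarrow> (\<forall>x\<in>A. \<exists>Y. mean_value_curve (\<lambda>_. F) 0 Y \<and> Y 0 = x \<and> (Y \<longlongrightarrow> 0) at_top)"

lemma basin_of_attraction_curve_attractive:
  fixes F :: "'a \<Rightarrow> 'a::euclidean_space"
  shows "curve_attractive F (basin_of_attraction F t0 0)"
  unfolding curve_attractive_def
proof
  fix x assume "x \<in> basin_of_attraction F t0 0"
  then obtain z where z: "caratheodory_solution (\<lambda>t. F) t0 x z" "(z \<longlongrightarrow> 0) at_top"
    unfolding basin_of_attraction_def by blast
  have "((\<lambda>t. z (t + t0)) \<longlongrightarrow> 0) at_top"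
    by (rule filterlim_compose[OF z(2)])
      (use filterlim_tendsto_add_at_top[OF tendsto_const filterlim_ident, of t0] in \<open>simp add: add.commute\<close>)
  moreover have "z (0 + t0) = x" using z(1) by (simp add: caratheodory_solution_def)
  ultimately show "\<exists>Y. mean_value_curve (\<lambda>_. F) 0 Y \<and> Y 0 = x \<and> (Y \<longlongrightarrow> 0) at_top"
    using caratheodory_solution_imp_mean_value_curve_0[OF z(1)] by blast
qed

text \<open>Stages are to begin and end at multiples of \<open>T\<close>, where constancy intervals
  begin; \<open>N \<ge> 1\<close> makes each of them last at least \<open>T\<close>.\<close>

lemma tendsto_zero_multiple_small:
  fixes Y :: "real \<Rightarrow> 'a::real_normed_vector"
  assumes "(Y \<longlongrightarrow> 0) at_top" and "T > 0" and "\<epsilon> > 0"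
  obtains N :: nat where "N \<ge> 1" "norm (Y (real N * T)) < \<epsilon>"
proof -
  have "filterlim (\<lambda>n. real n * T) at_top sequentially"
    using filterlim_at_top_mult_tendsto_pos[OF tendsto_const assms(2) filterlim_real_sequentially] by (simp add: mult.commute)
  then have "(\<lambda>n. Y (real n * T)) \<longlonglongrightarrow> 0" by (rule filterlim_compose[OF assms(1)])
  then have "\<forall>\<^sub>F n in sequentially. norm (Y (real n * T)) < \<epsilon>"
    using assms(3) by (simp add: tendsto_iff)
  then have "\<forall>\<^sub>F n in sequentially. n \<ge> 1 \<and> norm (Y (real n * T)) < \<epsilon>"
    using eventually_ge_at_top[of 1] by eventually_elim auto
  then show thesis using that by (auto simp: eventually_sequentially)
qed

text \<open>Stability, continuous dependence on the initial value and compactness turn pointwise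
  attraction into uniform attraction.\<close>

lemma uniform_attraction:
  fixes F :: "'a \<Rightarrow> 'a::euclidean_space"
  assumes lip: "local_lipschitz {0::real} UNIV (\<lambda>_. F)" and T: "T > 0"
    and stable: "curve_stable F" and attr: "curve_attractive F A" and \<delta>: "\<delta> > 0" "ball 0 \<delta> \<subseteq> A"
  obtains r where "r > 0" "cball 0 r \<subseteq> A"
    "\<And>\<epsilon>. \<epsilon> > 0 \<Longrightarrow> \<exists>N\<ge>1::nat. \<forall>Y. mean_value_curve (\<lambda>_. F) 0 Y \<longrightarrow> norm (Y 0) \<le> r \<longrightarrow> norm (Y (real N * T)) < \<epsilon>"
proof -
  obtain \<delta>1 where \<delta>1: "\<delta>1 > 0"
    "\<And>h Y t. mean_value_curve (\<lambda>_. F) 0 Y \<Longrightarrow> 0 \<le> h \<Longrightarrow> norm (Y h) < \<delta>1 \<Longrightarrow> h \<le> t \<Longrightarrow> norm (Y t) < 1"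
    using curve_stableE[OF stable zero_less_one] by blast
  \<comment> \<open>Halving puts the closed ball inside the attracted ball and inside the stability
    ball for the bound 1; this 1 is the radius used for continuous dependence.\<close>
  define r where "r = min \<delta> \<delta>1 / 2"
  have r: "r > 0" "r < \<delta>" "r < \<delta>1" using \<delta> \<delta>1(1) by (auto simp: r_def min_def)
  have rA: "cball 0 r \<subseteq> A" using r \<delta>(2) by force
  show thesis
  proof (rule that[OF r(1) rA])
    fix \<epsilon> :: real assume \<epsilon>: "\<epsilon> > 0"
    obtain \<delta>' where \<delta>': "\<delta>' > 0"
      "\<And>h Y t. mean_value_curve (\<lambda>_. F) 0 Y \<Longrightarrow> 0 \<le> h \<Longrightarrow> norm (Y h) < \<delta>' \<Longrightarrow> h \<le> t \<Longrightarrow> norm (Y t) < \<epsilon>"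
      using curve_stableE[OF stable \<epsilon>] by blast
    have "\<exists>N \<rho>. \<rho> > 0 \<and> (\<forall>Y t. mean_value_curve (\<lambda>_. F) 0 Y \<longrightarrow> norm (Y 0 - p) \<le> \<rho> \<longrightarrow> real N * T \<le> t \<longrightarrow> norm (Y t) < \<epsilon>)"
      if p: "p \<in> cball 0 r" for p
    proof -
      obtain Yp where Yp: "mean_value_curve (\<lambda>_. F) 0 Yp" "Yp 0 = p" "(Yp \<longlongrightarrow> 0) at_top"
        using attr p rA unfolding curve_attractive_def by blast
      obtain N :: nat where N: "norm (Yp (real N * T)) < \<delta>' / 2"
        using tendsto_zero_multiple_small[OF Yp(3) T, of "\<delta>' / 2"] \<delta>'(1) by auto
      have "norm (Yp t) \<le> 1" if "0 \<le> t" for t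
        using \<delta>1(2)[OF Yp(1), of 0 t] Yp(2) p r that by simp
      moreover have "0 \<le> real N * T" "\<delta>' / 2 > 0" using T \<delta>'(1) by auto
      ultimately obtain \<rho> where \<rho>: "\<rho> > 0" "\<And>Y. mean_value_curve (\<lambda>_. F) 0 Y \<Longrightarrow> norm (Y 0 - p) \<le> \<rho> \<Longrightarrow>
          norm (Y (real N * T) - Yp (real N * T)) < \<delta>' / 2"
        using autonomous_continuous_dependence[OF lip T, of "\<delta>' / 2" N 1] Yp(1,2) by (metis order_refl)
      have "norm (Y t) < \<epsilon>" if Y: "mean_value_curve (\<lambda>_. F) 0 Y" "norm (Y 0 - p) \<le> \<rho>" "real N * T \<le> t" for Y t
      proof (rule \<delta>'(2)[OF Y(1) _ _ Y(3)])
        show "norm (Y (real N * T)) < \<delta>'"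
          using \<rho>(2)[OF Y(1,2)] N norm_triangle_sub[of "Y (real N * T)" "Yp (real N * T)"] by simp
      qed (use T in simp)
      then show ?thesis using \<rho>(1) by blast
    qed
    then obtain N \<rho> where N\<rho>: "\<And>p. p \<in> cball 0 r \<Longrightarrow> \<rho> p > 0"
      "\<And>p Y t. p \<in> cball 0 r \<Longrightarrow> mean_value_curve (\<lambda>_. F) 0 Y \<Longrightarrow> norm (Y 0 - p) \<le> \<rho> p \<Longrightarrow>
        real (N p) * T \<le> t \<Longrightarrow> norm (Y t) < \<epsilon>"
      by metis
    have cover: "cball 0 r \<subseteq> (\<Union>p\<in>cball 0 r. ball p (\<rho> p))" using N\<rho>(1) by force
    obtain P where P: "P \<subseteq> cball 0 r" "finite P" "cball 0 r \<subseteq> (\<Union>p\<in>P. ball p (\<rho> p))"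
      by (rule compactE_image[OF compact_cball _ cover]) auto
    \<comment> \<open>The sum exceeds every \<open>N p\<close> of the finite cover. A larger time is
      harmless, because stability has extended each local estimate to all later times;
      \<open>Suc\<close> ensures \<open>N' \<ge> 1\<close>.\<close>
    define N' where "N' = Suc (\<Sum>p\<in>P. N p)"
    have "norm (Y (real N' * T)) < \<epsilon>" if Y: "mean_value_curve (\<lambda>_. F) 0 Y" "norm (Y 0) \<le> r" for Y
    proof -
      have "Y 0 \<in> cball 0 r" using Y(2) by simp
      then obtain p where p: "p \<in> P" "Y 0 \<in> ball p (\<rho> p)" using P(3) by blast
      have "N p \<le> N'" using p P(2) by (auto simp: N'_def intro!: le_SucI member_le_sum)
      then have "real (N p) * T \<le> real N' * T" using T by simp
      then show ?thesis
        using p P(1) Y(1) by (intro N\<rho>(2)[of p]) (auto simp: dist_norm norm_minus_commute)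
    qed
    then show "\<exists>N\<ge>1::nat. \<forall>Y. mean_value_curve (\<lambda>_. F) 0 Y \<longrightarrow> norm (Y 0) \<le> r \<longrightarrow> norm (Y (real N * T)) < \<epsilon>"
      by (intro exI[of _ N']) (auto simp: N'_def)
  qed
qed

subsection \<open>Convergence of the scheduled system\<close>

text \<open>The comparison curve starts exactly at the current value of \<open>Z\<close>, so the
  initial error is 0. Half of \<open>d\<close> is left to the nominal curve and half to the
  deviation from it. The set \<open>D\<close> will be a single point at first and balls
  afterwards.\<close>

lemma averaging_stage:
  fixes G :: "nat \<Rightarrow> 'a \<Rightarrow> 'a::euclidean_space"
  assumes m: "1 \<le> m" and T: "T > 0"
    and lip: "\<And>k. k \<in> {1..m} \<Longrightarrow> local_lipschitz {0::real} UNIV (\<lambda>_. G k)"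
    and average: "\<And>x. real m *\<^sub>R F x = (\<Sum>k=1..m. G k x)"
    and curves: "\<And>x. x \<in> D \<Longrightarrow> \<exists>Y. mean_value_curve (\<lambda>_. F) 0 Y \<and> Y 0 = x \<and>
      (\<forall>t. 0 \<le> t \<longrightarrow> t \<le> real N * T \<longrightarrow> norm (Y t) \<le> R) \<and> norm (Y (real N * T)) < d / 2"
    and \<epsilon>: "\<epsilon> > 0" and d: "d > 0"
  shows "\<exists>\<eta>>0. \<forall>n \<tau> Z. switching_time_function T \<tau> \<longrightarrow> \<tau> (real n * T) \<le> \<eta> \<longrightarrow>
      mean_value_curve (\<lambda>s. G (sigma_hat m \<tau> s)) 0 Z \<longrightarrow> Z (real n * T) \<in> D \<longrightarrow>
      norm (Z (real (n + N) * T)) < d \<and>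
      (\<forall>s. real n * T \<le> s \<longrightarrow> s \<le> real (n + N) * T \<longrightarrow> norm (Z s) < R + \<epsilon>)"
proof -
  have "min \<epsilon> (d / 2) > 0" using \<epsilon> d by simp
  from averaging_closeness[where N = N and R = R, OF m T this lip average]
  obtain \<rho> \<eta> where \<rho>: "\<rho> > 0" and \<eta>: "\<eta> > 0" and close:
    "\<And>n \<tau> Z Y s. switching_time_function T \<tau> \<Longrightarrow> \<tau> (real n * T) \<le> \<eta> \<Longrightarrow>
      mean_value_curve (\<lambda>s. G (sigma_hat m \<tau> s)) (real n * T) Z \<Longrightarrow>
      mean_value_curve (\<lambda>_. F) (real n * T) Y \<Longrightarrow>
      (\<And>s. real n * T \<le> s \<Longrightarrow> s \<le> real (n + N) * T \<Longrightarrow> norm (Y s) \<le> R) \<Longrightarrow>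
      norm (Z (real n * T) - Y (real n * T)) \<le> \<rho> \<Longrightarrow>
      real n * T \<le> s \<Longrightarrow> s \<le> real (n + N) * T \<Longrightarrow> norm (Z s - Y s) < min \<epsilon> (d / 2)"
    by blast
  show ?thesis
  proof (intro exI[of _ \<eta>] conjI[OF \<eta>] allI impI)
    fix n :: nat and \<tau> Z
    assume \<tau>: "switching_time_function T \<tau>" "\<tau> (real n * T) \<le> \<eta>"
      and Z: "mean_value_curve (\<lambda>s. G (sigma_hat m \<tau> s)) 0 Z" and start: "Z (real n * T) \<in> D"
    define a where "a = real n * T"
    have a: "a \<ge> 0" "real (n + N) * T = a + real N * T" using T by (simp_all add: a_def algebra_simps)
    obtain Y where Y: "mean_value_curve (\<lambda>_. F) 0 Y" "Y 0 = Z a"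
      "\<And>t. 0 \<le> t \<Longrightarrow> t \<le> real N * T \<Longrightarrow> norm (Y t) \<le> R" "norm (Y (real N * T)) < d / 2"
      using curves[OF start] unfolding a_def by blast
    have near: "norm (Z s - Y (s - a)) < min \<epsilon> (d / 2)" if "a \<le> s" "s \<le> a + real N * T" for s
    proof (rule close[of \<tau> n Z "\<lambda>s. Y (s - a)" s, folded a_def, unfolded a(2), OF \<tau>(1) \<tau>(2)[folded a_def] _ _ _ _ that])
      show "mean_value_curve (\<lambda>s. G (sigma_hat m \<tau> s)) a Z"
        by (rule mean_value_curve_restrict[OF Z a(1)])
      show "mean_value_curve (\<lambda>_. F) a (\<lambda>s. Y (s - a))"
        using mean_value_curve_shift[OF Y(1), of a "- a"] by simp
    qed (use Y \<rho> in auto)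
    show "norm (Z (real (n + N) * T)) < d \<and>
        (\<forall>s. real n * T \<le> s \<longrightarrow> s \<le> real (n + N) * T \<longrightarrow> norm (Z s) < R + \<epsilon>)"
      unfolding a(2) a_def[symmetric]
    proof (intro conjI allI impI)
      have "norm (Z (a + real N * T) - Y (real N * T)) < d / 2" using near[of "a + real N * T"] T by simp
      then show "norm (Z (a + real N * T)) < d"
        using Y(4) norm_triangle_sub[of "Z (a + real N * T)" "Y (real N * T)"] by simp
      fix s assume s: "a \<le> s" "s \<le> a + real N * T"
      then show "norm (Z s) < R + \<epsilon>"
        using near[OF s] Y(3)[of "s - a"] norm_triangle_sub[of "Z s" "Y (s - a)"] by simp
    qed
  qed
qed

lemma switched_curve_tendsto_zero:
  fixes G :: "nat \<Rightarrow> 'a \<Rightarrow> 'a::euclidean_space"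
  assumes m: "1 \<le> m" and T: "T > 0"
    and lip: "\<And>k. k \<in> {1..m} \<Longrightarrow> local_lipschitz {0::real} UNIV (\<lambda>_. G k)"
    and average: "\<And>x. real m *\<^sub>R F x = (\<Sum>k=1..m. G k x)"
    and lipF: "local_lipschitz {0::real} UNIV (\<lambda>_. F)"
    and stable: "curve_stable F" and attr: "curve_attractive F A" and \<delta>: "\<delta> > 0" "ball 0 \<delta> \<subseteq> A"
    and x: "x \<in> A"
  obtains \<tau>' where "switching_time_function T \<tau>'"
    "\<And>\<tau> Z. switching_time_function T \<tau> \<Longrightarrow> dominates \<tau> \<tau>' \<Longrightarrow>
      mean_value_curve (\<lambda>s. G (sigma_hat m \<tau> s)) 0 Z \<Longrightarrow> Z 0 = x \<Longrightarrow> (Z \<longlongrightarrow> 0) at_top"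
proof -
  obtain r where r: "r > 0" "cball 0 r \<subseteq> A" and unif: "\<And>\<epsilon>. \<epsilon> > 0 \<Longrightarrow>
      \<exists>N\<ge>1::nat. \<forall>Y. mean_value_curve (\<lambda>_. F) 0 Y \<longrightarrow> norm (Y 0) \<le> r \<longrightarrow> norm (Y (real N * T)) < \<epsilon>"
    by (rule uniform_attraction[OF lipF T stable attr \<delta>]) blast
  define \<epsilon> where "\<epsilon> n = inverse (real (Suc n))" for n
  have \<epsilon>: "\<epsilon> n > 0" for n by (simp add: \<epsilon>_def)
  \<comment> \<open>Stability confines nominal curves from the ball of radius \<open>d n\<close> to
    norm below \<open>\<epsilon> n\<close>, while \<open>d n \<le> r\<close> makes the uniform
    attraction time applicable.\<close>
  have "\<exists>d>0. d \<le> r \<and> (\<forall>Y t. mean_value_curve (\<lambda>_. F) 0 Y \<longrightarrow> norm (Y 0) < d \<longrightarrow> 0 \<le> t \<longrightarrow> norm (Y t) < \<epsilon> n)" for n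
  proof -
    obtain \<delta>' where "\<delta>' > 0" "\<And>h Y t. mean_value_curve (\<lambda>_. F) 0 Y \<Longrightarrow> 0 \<le> h \<Longrightarrow> norm (Y h) < \<delta>' \<Longrightarrow> h \<le> t \<Longrightarrow> norm (Y t) < \<epsilon> n"
      using curve_stableE[OF stable \<epsilon>] by blast
    then show ?thesis using r(1) by (intro exI[of _ "min \<delta>' r"]) auto
  qed
  then obtain d where d: "\<And>n. d n > 0" "\<And>n. d n \<le> r"
    "\<And>n Y t. mean_value_curve (\<lambda>_. F) 0 Y \<Longrightarrow> norm (Y 0) < d n \<Longrightarrow> 0 \<le> t \<Longrightarrow> norm (Y t) < \<epsilon> n"
    by metis
  \<comment> \<open>Quantified over all starting indices, since the actual start of a stage is known
    only after the lengths of all earlier ones are chosen.\<close>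
  define stage where "stage D N \<eta> d' R \<longleftrightarrow> (\<forall>n \<tau> Z. switching_time_function T \<tau> \<longrightarrow> \<tau> (real n * T) \<le> \<eta> \<longrightarrow>
      mean_value_curve (\<lambda>s. G (sigma_hat m \<tau> s)) 0 Z \<longrightarrow> Z (real n * T) \<in> D \<longrightarrow>
      norm (Z (real (n + N) * T)) < d' \<and>
      (\<forall>s. real n * T \<le> s \<longrightarrow> s \<le> real (n + N) * T \<longrightarrow> norm (Z s) < R))" for D and N :: nat and \<eta> d' R :: real
  have "\<exists>N \<eta>. 1 \<le> N \<and> 0 < \<eta> \<and> stage (ball 0 (d n)) N \<eta> (d (Suc n)) (2 * \<epsilon> n)" for n
  proof -
    have "d (Suc n) / 2 > 0" using d(1) by simp
    then obtain N :: nat where N: "N \<ge> 1"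
      "\<And>Y. mean_value_curve (\<lambda>_. F) 0 Y \<Longrightarrow> norm (Y 0) \<le> r \<Longrightarrow> norm (Y (real N * T)) < d (Suc n) / 2"
      using unif by metis
    have "\<exists>Y. mean_value_curve (\<lambda>_. F) 0 Y \<and> Y 0 = y \<and>
        (\<forall>t. 0 \<le> t \<longrightarrow> t \<le> real N * T \<longrightarrow> norm (Y t) \<le> \<epsilon> n) \<and> norm (Y (real N * T)) < d (Suc n) / 2"
      if y: "y \<in> ball 0 (d n)" for y
    proof -
      have yr: "norm y < d n" "norm y \<le> r" using y d(2)[of n] by auto
      then have "y \<in> A" using r(2) by auto
      then obtain Y where "mean_value_curve (\<lambda>_. F) 0 Y" "Y 0 = y"
        using attr unfolding curve_attractive_def by blast
      then show ?thesis using d(3)[of Y n] N(2)[of Y] yr by (auto intro!: exI[of _ Y] less_imp_le)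
    qed
    from averaging_stage[OF m T lip average this \<epsilon> d(1)]
    have "\<exists>\<eta>>0. stage (ball 0 (d n)) N \<eta> (d (Suc n)) (\<epsilon> n + \<epsilon> n)"
      unfolding stage_def .
    then show ?thesis using N(1) by auto
  qed
  then obtain N \<eta> where N: "\<And>n. 1 \<le> N n" "\<And>n. 0 < \<eta> n" "\<And>n. stage (ball 0 (d n)) (N n) (\<eta> n) (d (Suc n)) (2 * \<epsilon> n)"
    by metis
  \<comment> \<open>The entry stage leads from \<open>x\<close> into the first ball. The basin may
    be large, so its bound comes from compactness of one nominal arc, not from stability.\<close>
  obtain N0 \<eta>0 R0 where N0: "1 \<le> N0" "0 < \<eta>0" "stage {x} N0 \<eta>0 (d 0) R0"
  proof -
    obtain Y where Y: "mean_value_curve (\<lambda>_. F) 0 Y" "Y 0 = x" "(Y \<longlongrightarrow> 0) at_top"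
      using attr x unfolding curve_attractive_def by blast
    have "d 0 / 2 > 0" using d(1) by simp
    then obtain N0 :: nat where N0: "N0 \<ge> 1" "norm (Y (real N0 * T)) < d 0 / 2"
      using tendsto_zero_multiple_small[OF Y(3) T] by blast
    have "compact (Y ` {0..real N0 * T})"
      by (intro compact_continuous_image continuous_on_subset[OF mean_value_curveD(1)[OF Y(1)]]) auto
    then obtain R where "\<And>t. 0 \<le> t \<Longrightarrow> t \<le> real N0 * T \<Longrightarrow> norm (Y t) \<le> R"
      using compact_imp_bounded by (force simp: bounded_iff)
    then have "\<exists>Y. mean_value_curve (\<lambda>_. F) 0 Y \<and> Y 0 = y \<and>
        (\<forall>t. 0 \<le> t \<longrightarrow> t \<le> real N0 * T \<longrightarrow> norm (Y t) \<le> R) \<and> norm (Y (real N0 * T)) < d 0 / 2"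
      if "y \<in> {x}" for y using Y N0(2) that by blast
    from averaging_stage[OF m T lip average this zero_less_one d(1)]
    have "\<exists>\<eta>>0. stage {x} N0 \<eta> (d 0) (R + 1)"
      unfolding stage_def .
    then show thesis using that N0(1) by blast
  qed
  \<comment> \<open>The start of stage \<open>n\<close> in units of \<open>T\<close>, after the
    entry stage.\<close>
  define q where "q n = N0 + (\<Sum>i<n. N i)" for n
  have q: "q 0 = N0" "q (Suc n) = q n + N n" for n by (simp_all add: q_def)
  \<comment> \<open>Stage \<open>n\<close> has its threshold at index \<open>Suc n\<close> of
    \<open>\<eta>'\<close>, index 0 being the entry stage. As it starts no earlier than
    \<open>Suc n\<close>, its threshold is already met by then.\<close>
  have q_ge: "Suc n \<le> q n" for n
  proof (induction n)
    case (Suc n)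
    then show ?case using N(1)[of n] by (simp add: q)
  qed (use N0 q in auto)
  define \<eta>' where "\<eta>' i = (case i of 0 \<Rightarrow> \<eta>0 | Suc n \<Rightarrow> \<eta> n)" for i
  have \<eta>': "\<eta>' i > 0" for i using N(2) N0(2) by (simp add: \<eta>'_def split: nat.split)
  \<comment> \<open>The running minimum makes the thresholds non-increasing and respects all earlier
    ones.\<close>
  define \<mu> where "\<mu> j = Min (\<eta>' ` {..j})" for j
  have \<mu>_pos: "\<mu> j > 0" for j using \<eta>' by (auto simp: \<mu>_def)
  have \<mu>_le: "\<mu> j \<le> \<eta>' i" if "i \<le> j" for i j using that by (auto simp: \<mu>_def)
  have \<mu>_anti: "\<mu> j \<le> \<mu> i" if "i \<le> j" for i j
    unfolding \<mu>_def using that by (intro Min_antimono) auto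
  \<comment> \<open>The minima need not tend to 0; the factor enforces it.\<close>
  define h where "h j = \<mu> j * inverse (real (Suc j))" for j
  have h_pos: "h j > 0" for j using \<mu>_pos by (simp add: h_def)
  have h_le: "h j \<le> \<eta>' i" if "i \<le> j" for i j
  proof -
    have "h j \<le> \<mu> j * 1" unfolding h_def using \<mu>_pos[of j]
      by (intro mult_left_mono) (auto simp: inverse_le_1_iff)
    then show ?thesis using \<mu>_le[OF that] by simp
  qed
  define \<tau>' where "\<tau>' s = h (nat \<lfloor>s / T\<rfloor>)" for s
  have \<tau>'_at: "\<tau>' (real n * T) = h n" for n using T by (simp add: \<tau>'_def)
  show thesis
  proof (rule that)
    show "switching_time_function T \<tau>'"
      unfolding \<tau>'_def
    proof (rule switching_time_function_step[OF T h_pos])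
      show "antimono h"
        unfolding h_def using \<mu>_pos[THEN less_imp_le]
        by (intro antimonoI mult_mono \<mu>_anti le_imp_inverse_le) auto
      show "h \<longlonglongrightarrow> 0"
      proof (rule Lim_null_comparison)
        show "\<forall>\<^sub>F j in sequentially. norm (h j) \<le> \<mu> 0 * inverse (real (Suc j))"
          using \<mu>_anti[of 0] \<mu>_pos by (intro always_eventually allI) (auto simp: h_def abs_mult less_imp_le intro!: mult_right_mono)
        show "(\<lambda>j. \<mu> 0 * inverse (real (Suc j))) \<longlonglongrightarrow> 0"
          using tendsto_mult_right_zero[OF LIMSEQ_inverse_real_of_nat] .
      qed
    qed
    fix \<tau> Z
    assume \<tau>: "switching_time_function T \<tau>" "dominates \<tau> \<tau>'"
      and Z: "mean_value_curve (\<lambda>s. G (sigma_hat m \<tau> s)) 0 Z" "Z 0 = x"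
    have \<tau>_le: "\<tau> (real n * T) \<le> \<eta>' i" if "i \<le> n" for n i
    proof -
      have "\<tau> (real n * T) \<le> \<tau>' (real n * T)" using \<tau>(2) T by (simp add: dominates_def)
      then show ?thesis using h_le[OF that] by (simp add: \<tau>'_at)
    qed
    have reach: "norm (Z (real (q n) * T)) < d n" for n
    proof (induction n)
      case 0
      show ?case
        using N0(3)[unfolded stage_def, rule_format, of \<tau> 0 Z] \<tau>(1) \<tau>_le[of 0 0] Z by (simp add: q \<eta>'_def)
    next
      case (Suc n)
      then show ?case
        using N(3)[of n, unfolded stage_def, rule_format, of \<tau> "q n" Z] \<tau>(1) \<tau>_le[OF q_ge[of n]] Z
        by (simp add: q \<eta>'_def)
    qed
    have small: "norm (Z s) < 2 * \<epsilon> n" if "real (q n) * T \<le> s" "s \<le> real (q (Suc n)) * T" for n s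
      using N(3)[of n, unfolded stage_def, rule_format, of \<tau> "q n" Z] \<tau>(1) \<tau>_le[OF q_ge[of n]] Z(1) reach[of n] that
      by (simp add: q(2) \<eta>'_def)
    \<comment> \<open>Passing to later stages keeps the bound of stage \<open>n\<close>, because
      \<open>\<epsilon>\<close> decreases.\<close>
    have later: "norm (Z s) < 2 * \<epsilon> n" if "real (q n) * T \<le> s" "s \<le> real (q (n + k)) * T" for n k s
      using that
    proof (induction k)
      case 0
      have "q n \<le> q (Suc n)" by (simp add: q(2))
      then have "real (q n) * T \<le> real (q (Suc n)) * T" using T by simp
      then show ?case using 0 small[of n s] by simp
    next
      case (Suc k)
      show ?case
      proof (cases "s \<le> real (q (n + k)) * T")
        case False
        then have "norm (Z s) < 2 * \<epsilon> (n + k)" using Suc.prems by (intro small) auto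
        also have "\<dots> \<le> 2 * \<epsilon> n" by (simp add: \<epsilon>_def le_imp_inverse_le)
        finally show ?thesis .
      qed (use Suc in simp)
    qed
    show "(Z \<longlongrightarrow> 0) at_top"
      unfolding tendsto_iff
    proof (intro allI impI)
      fix e :: real assume "e > 0"
      then obtain n where n: "inverse (real (Suc n)) < e / 2"
        using reals_Archimedean[of "e / 2"] by auto
      have "dist (Z s) 0 < e" if s: "real (q n) * T \<le> s" for s
      proof -
        obtain k :: nat where k: "s / T \<le> real k" using real_arch_simple by blast
        have "real k \<le> real (q (n + k))" using q_ge[of "n + k"] by linarith
        then have "real k * T \<le> real (q (n + k)) * T" using T by (intro mult_right_mono) auto
        moreover have "s \<le> real k * T" using k T by (simp add: divide_le_eq)
        ultimately have "norm (Z s) < 2 * \<epsilon> n" by (intro later[OF s, of k]) simp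
        then show ?thesis using n by (simp add: \<epsilon>_def)
      qed
      then show "\<forall>\<^sub>F s in at_top. dist (Z s) 0 < e"
        unfolding eventually_at_top_linorder by blast
    qed
  qed
qed

section \<open>Local Lipschitz continuity of the components, and the conclusion\<close>

lemma local_lipschitz_singletonI:
  assumes "\<And>x. \<exists>u>0. \<exists>L. L-lipschitz_on (cball x u) F"
  shows "local_lipschitz {0::real} UNIV (\<lambda>_. F)"
  unfolding local_lipschitz_def
proof (intro ballI)
  fix x t
  obtain u L where "u > 0" "L-lipschitz_on (cball x u) F" using assms by blast
  then show "\<exists>u>0. \<exists>L. \<forall>t\<in>cball t u \<inter> {0}. L-lipschitz_on (cball x u \<inter> UNIV) F"
    by (intro exI[of _ u]) auto
qed

text \<open>The initial switching time \<open>T / m\<close> makes the schedule visit every component in \<open>[0, T)\<close>.\<close>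

lemma scheduled_component_local_lipschitz:
  fixes f :: "'a \<Rightarrow> 'a::euclidean_space"
  assumes T: "T > 0" and k: "k \<in> {1..m}"
    and wp: "\<And>\<tau>. switching_time_function T \<tau> \<Longrightarrow> well_posed (scheduled_field m f g \<kappa> \<tau> t0) t0"
  shows "local_lipschitz {0::real} UNIV (\<lambda>_ \<xi>. f \<xi> + (real m * \<kappa> k \<xi>) *\<^sub>R g k \<xi>)"
proof (rule local_lipschitz_singletonI)
  fix x
  define c where "c = T / real m"
  define \<tau> where "\<tau> = (\<lambda>s. c * inverse (real (Suc (nat \<lfloor>s / T\<rfloor>))))"
  have c: "c > 0" "real m * c = T" using T k by (auto simp: c_def)
  have "switching_time_function T \<tau>"
    unfolding \<tau>_def by (rule switching_time_function_inverse[OF T c(1)])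
  from wp[OF this] have "local_lipschitz {t0..} UNIV (scheduled_field m f g \<kappa> \<tau> t0)"
    by (simp add: well_posed_def)
  \<comment> \<open>The start of slot \<open>k\<close> in the first period, which fills exactly the
    first constancy interval. At this single time the scheduled field is component \<open>k\<close>,
    and Lipschitz continuity in the state there is all that is wanted.\<close>
  moreover define s where "s = real (k - 1) * c"
  have s: "0 \<le> s" "s < real k * c" using c k by (auto simp: s_def)
  ultimately obtain u L where u: "u > 0" "\<And>t. t \<in> cball (s + t0) u \<inter> {t0..} \<Longrightarrow>
      L-lipschitz_on (cball x u \<inter> UNIV) (scheduled_field m f g \<kappa> \<tau> t0 t)"
    unfolding local_lipschitz_def by (metis UNIV_I atLeast_iff le_add_same_cancel2)
  have "real k * c \<le> real m * c" using c k by (intro mult_right_mono) auto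
  then have "\<lfloor>s / T\<rfloor> = 0" using s c T by (intro floor_unique) auto
  then have "\<tau> s = c" by (simp add: \<tau>_def)
  then have "sigma_hat m \<tau> s = k"
    using k c s by (intro sigma_hat_slot[where \<theta> = c and j = 0]) (auto simp: s_def)
  then have "scheduled_field m f g \<kappa> \<tau> t0 (s + t0) = (\<lambda>\<xi>. f \<xi> + (real m * \<kappa> k \<xi>) *\<^sub>R g k \<xi>)"
    by (simp add: scheduled_field_def fun_eq_iff)
  then show "\<exists>u>0. \<exists>L. L-lipschitz_on (cball x u) (\<lambda>\<xi>. f \<xi> + (real m * \<kappa> k \<xi>) *\<^sub>R g k \<xi>)"
    using u(1) u(2)[of "s + t0"] s by auto
qed

theorem theorem2p10:
  fixes m :: nat
    and f :: "real^'d \<Rightarrow> real^'d"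
    and g :: "nat \<Rightarrow> real^'d \<Rightarrow> real^'d"
    and \<kappa> :: "nat \<Rightarrow> real^'d \<Rightarrow> real"
    and t0 T :: real
  assumes m_pos: "m \<ge> 1"
    and f_C1: "C1_on UNIV f"
    and g_C1: "\<And>k. k \<in> {1..m} \<Longrightarrow> C1_on UNIV (g k)"
    and hyperbolic: "hyperbolic_equilibrium (nominal_field m f g \<kappa>) 0"
    and stable: "locally_asymptotically_stable_equilibrium (nominal_field m f g \<kappa>) t0 0"
    and C2: "\<exists>U. open U \<and> 0 \<in> U \<and> C2_on U (nominal_field m f g \<kappa>)"
    and f_zero: "f 0 = 0"
    and \<kappa>_zero: "\<And>k. k \<in> {1..m} \<Longrightarrow> \<kappa> k 0 = 0"
    and t0_nonneg: "t0 \<ge> 0"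
    and T_pos: "T > 0"
    and nominal_well_posed: "well_posed (\<lambda>t. nominal_field m f g \<kappa>) t0"
    and scheduled_well_posed:
      "\<And>\<tau>. switching_time_function T \<tau> \<Longrightarrow> well_posed (scheduled_field m f g \<kappa> \<tau> t0) t0"
  shows "\<forall>xbar \<in> basin_of_attraction (nominal_field m f g \<kappa>) t0 0.
    \<exists>\<tau>'. switching_time_function T \<tau>' \<and>
      (\<forall>\<tau>. switching_time_function T \<tau> \<and> dominates \<tau> \<tau>' \<longrightarrow>
        (\<forall>z. caratheodory_solution (scheduled_field m f g \<kappa> \<tau> t0) t0 xbar z \<longrightarrow>
          (z \<longlongrightarrow> 0) at_top))"
proof
  let ?F = "nominal_field m f g \<kappa>"
  define G where "G k \<xi> = f \<xi> + (real m * \<kappa> k \<xi>) *\<^sub>R g k \<xi>" for k \<xi>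
  fix xbar assume x: "xbar \<in> basin_of_attraction ?F t0 0"
  have lip: "local_lipschitz {0::real} UNIV (\<lambda>_. G k)" if "k \<in> {1..m}" for k
    unfolding G_def by (rule scheduled_component_local_lipschitz[OF T_pos that scheduled_well_posed])
  \<comment> \<open>Each component is active for the fraction \<open>1 / m\<close> of a period; the
    factor \<open>m\<close> in the scheduled field makes up for this.\<close>
  have average: "real m *\<^sub>R ?F \<xi> = (\<Sum>k=1..m. G k \<xi>)" for \<xi>
    by (simp add: G_def nominal_field_def sum.distrib scaleR_sum_right scaleR_add_right sum_constant_scaleR del: sum_constant)
  have lip0: "local_lipschitz {t0..} UNIV (\<lambda>_. ?F)"
    using nominal_well_posed by (simp add: well_posed_def)
  then have F: "continuous_on UNIV ?F"
    by (rule local_lipschitz_continuous_on[where t = t0]) simp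
  have lipF: "local_lipschitz {0::real} UNIV (\<lambda>_. ?F)"
  proof (rule local_lipschitz_singletonI)
    fix \<xi>
    obtain u L where u: "u > 0" "\<forall>t\<in>cball t0 u \<inter> {t0..}. L-lipschitz_on (cball \<xi> u \<inter> UNIV) ?F"
      using lip0 unfolding local_lipschitz_def by (metis UNIV_I atLeast_iff order_refl)
    have "L-lipschitz_on (cball \<xi> u) ?F" using bspec[OF u(2), of t0] u(1) by simp
    then show "\<exists>u>0. \<exists>L. L-lipschitz_on (cball \<xi> u) ?F" using u(1) by blast
  qed
  obtain \<delta> where \<delta>: "\<delta> > 0" "ball 0 \<delta> \<subseteq> basin_of_attraction ?F t0 0" and "lyapunov_stable ?F t0 0"
    using stable unfolding locally_asymptotically_stable_equilibrium_def by blast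
  then have "curve_stable ?F" by (intro lyapunov_stable_imp_curve_stable F)
  from switched_curve_tendsto_zero[OF m_pos T_pos lip average lipF this
      basin_of_attraction_curve_attractive \<delta> x]
  obtain \<tau>' where \<tau>': "switching_time_function T \<tau>'"
    "\<And>\<tau> Z. switching_time_function T \<tau> \<Longrightarrow> dominates \<tau> \<tau>' \<Longrightarrow>
      mean_value_curve (\<lambda>s. G (sigma_hat m \<tau> s)) 0 Z \<Longrightarrow> Z 0 = xbar \<Longrightarrow> (Z \<longlongrightarrow> 0) at_top"
    by blast
  have "(z \<longlongrightarrow> 0) at_top"
    if \<tau>: "switching_time_function T \<tau>" "dominates \<tau> \<tau>'"
      and z: "caratheodory_solution (scheduled_field m f g \<kappa> \<tau> t0) t0 xbar z" for \<tau> z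
  proof -
    have "(\<lambda>s. scheduled_field m f g \<kappa> \<tau> t0 (s + t0)) = (\<lambda>s. G (sigma_hat m \<tau> s))"
      by (simp add: scheduled_field_def G_def Let_def fun_eq_iff)
    then have "mean_value_curve (\<lambda>s. G (sigma_hat m \<tau> s)) 0 (\<lambda>s. z (s + t0))"
      using caratheodory_solution_imp_mean_value_curve_0[OF z] by simp
    moreover have "z (0 + t0) = xbar" using z by (simp add: caratheodory_solution_def)
    ultimately have lim: "((\<lambda>s. z (s + t0)) \<longlongrightarrow> 0) at_top" by (rule \<tau>'(2)[OF \<tau>])
    have "filterlim (\<lambda>t. t - t0) at_top at_top"
      using filterlim_tendsto_add_at_top[OF tendsto_const filterlim_ident, of "- t0"] by simp
    from filterlim_compose[OF lim this] show ?thesis by simp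
  qed
  then show "\<exists>\<tau>'. switching_time_function T \<tau>' \<and>
      (\<forall>\<tau>. switching_time_function T \<tau> \<and> dominates \<tau> \<tau>' \<longrightarrow>
        (\<forall>z. caratheodory_solution (scheduled_field m f g \<kappa> \<tau> t0) t0 xbar z \<longrightarrow> (z \<longlongrightarrow> 0) at_top))"
    using \<tau>'(1) by blast
qed

end
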